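(* Let $X \subset \mathbb{R}^2$ be bounded, let $\theta \in (0,1)$, and let $\alpha \in [0,1)$. Then $$\dim_{\mathrm{H}} \biggl\{ V \in G(2,1) : \dim_{\mathrm{A}}^{\theta} P_V X > \frac{1}{1+\alpha}\biggl(\frac{\overline{\dim}_{\mathrm{B}} X}{1-\theta} + \alpha \dim_{\mathrm{A}}^{\theta} X\biggr)\biggr\} \ \leq \ \alpha.$$
   Context: $G(2,1)$ is the Grassmannian of $1$-dimensional linear subspaces $V \subseteq \mathbb{R}^2$, with the metric given by the acute angle between lines. $P_V \colon \mathbb{R}^2 \to V$ is orthogonal projection onto $V$, and $V$ is identified with $\mathbb{R}$. $\dim_{\mathrm{H}}$ is Hausdorff dimension (with $\dim_{\mathrm{H}} \emptyset = 0$). $B(x,R)$ is the closed ball with centre $x$ and radius $R$. $N_r(A)$ is the smallest number of closed balls of radius $r>0$ needed to cover the bounded set $A$. Assouad spectrum: for $X \subseteq \mathbb{R}^m$ and $\theta \in (0,1)$, $\dim_{\mathrm{A}}^\theta X$ is the infimum of all $\alpha \geq 0$ for which there exists a constant $C>0$ such that $N_{R^{1/\theta}}(X \cap B(x,R)) \leq C (R/R^{1/\theta})^\alpha$ for all $0<R<1$ and all $x \in X$. Upper box dimension: for bounded $X$, $\overline{\dim}_{\mathrm{B}} X = \limsup_{r \downarrow 0} \frac{\log N_r(X)}{-\log r}$ (the empty set having dimension $0$ by convention). *)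

theory Defs
  imports "HOL-Analysis.Analysis"
begin

section \<open>Hausdorff dimension in a metric space\<close>

context Metric_space
begin

definition ediam :: "'a set \<Rightarrow> ennreal" where
  "ediam U = (SUP x\<in>U. SUP y\<in>U. ennreal (d x y))"

text \<open>
  The summand \<open>diam(U)^s\<close>.  The library has \<open>0 powr 0 = 0\<close>, so the usual
  convention for \<open>s = 0\<close> (nonempty sets count \<open>1\<close>, the empty set counts \<open>0\<close>) is written out.
  It is only used on sets of finite diameter, where \<open>enn2real\<close> is faithful.
\<close>

definition diam_pow :: "real \<Rightarrow> 'a set \<Rightarrow> ennreal" where
  "diam_pow s U =
     (if U = {} then 0 else if s = 0 then 1 else ennreal (enn2real (ediam U) powr s))"

definition hausdorff_premeasure :: "real \<Rightarrow> real \<Rightarrow> 'a set \<Rightarrow> ennreal" where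
  "hausdorff_premeasure s \<delta> A =
     (INF U \<in> {U :: nat \<Rightarrow> 'a set.
                 A \<subseteq> (\<Union>i. U i) \<and> (\<forall>i. U i \<subseteq> M \<and> ediam (U i) \<le> ennreal \<delta>)}.
        (\<Sum>i. diam_pow s (U i)))"

definition hausdorff_measure :: "real \<Rightarrow> 'a set \<Rightarrow> ennreal" where
  "hausdorff_measure s A = (SUP \<delta> \<in> {0<..}. hausdorff_premeasure s \<delta> A)"

definition hausdorff_dim :: "'a set \<Rightarrow> ereal" where
  "hausdorff_dim A = (INF s \<in> {s. 0 \<le> s \<and> hausdorff_measure s A = 0}. ereal s)"

end


section \<open>Covering numbers, upper box dimension, Assouad spectrum\<close>

definition covering_number :: "real \<Rightarrow> 'a::euclidean_space set \<Rightarrow> nat" where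
  "covering_number r A = (LEAST n. \<exists>C. finite C \<and> card C = n \<and> A \<subseteq> (\<Union>c\<in>C. cball c r))"

definition upper_box_dim :: "'a::euclidean_space set \<Rightarrow> ereal" where
  "upper_box_dim X =
     (if X = {} then 0
      else Limsup (at_right 0) (\<lambda>r::real. ereal (ln (real (covering_number r X)) / (- ln r))))"

definition assouad_spectrum :: "real \<Rightarrow> 'a::euclidean_space set \<Rightarrow> ereal" where
  "assouad_spectrum \<theta> X =
     (INF \<alpha> \<in> {\<alpha>. 0 \<le> \<alpha> \<and>
                  (\<exists>C>0. \<forall>R. 0 < R \<longrightarrow> R < 1 \<longrightarrow> (\<forall>x\<in>X.
                     real (covering_number (R powr (1 / \<theta>)) (X \<inter> cball x R))
                       \<le> C * (R / R powr (1 / \<theta>)) powr \<alpha>))}.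
        ereal \<alpha>)"


section \<open>The Grassmannian of lines in the plane, and projections onto lines\<close>

definition G21 :: "(real^2) set set" where
  "G21 = {V. subspace V \<and> dim V = 1}"

text \<open>
  Unit vectors spanning two lines are determined up to sign, so there are at most two values of
  the angle between them, and the acute angle is the smaller one.  The value \<open>0\<close> outside
  \<open>G21\<close> is there because \<open>Metric_space\<close> demands nonnegativity and symmetry on the whole type.
\<close>

definition line_angle :: "(real^2) set \<Rightarrow> (real^2) set \<Rightarrow> real" where
  "line_angle V W =
     (if V \<in> G21 \<and> W \<in> G21
      then Inf {arccos (u \<bullet> v) | u v. u \<in> V \<and> v \<in> W \<and> norm u = 1 \<and> norm v = 1}
      else 0)"

definition orth_proj :: "(real^2) set \<Rightarrow> real^2 \<Rightarrow> real^2" where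
  "orth_proj V x = (THE y. y \<in> V \<and> (\<forall>w\<in>V. (x - y) \<bullet> w = 0))"

text \<open>
  The identification of a line with the reals: a linear isometry, unique up to sign.
\<close>

definition line_coord :: "(real^2) set \<Rightarrow> real^2 \<Rightarrow> real" where
  "line_coord V = (SOME f. linear f \<and> (\<forall>v\<in>V. norm (f v) = norm v))"

definition line_proj :: "(real^2) set \<Rightarrow> real^2 \<Rightarrow> real" where
  "line_proj V x = line_coord V (orth_proj V x)"

lemma G21_obtain:
  assumes "V \<in> G21"
  obtains u where "norm u = 1" "V = span {u}"
proof -
  from assms have V: "subspace V" "dim V = 1" by (auto simp: G21_def)
  obtain B where B: "B \<subseteq> V" "independent B" "V \<subseteq> span B" "card B = dim V"
    using basis_exists by blast
  with V obtain b where b: "B = {b}" by (auto simp: card_1_singleton_iff)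
  with B have "b \<noteq> 0" using dependent_zero by blast
  have "V = span {b}" using B b V by (metis span_minimal subset_antisym)
  also have "\<dots> = span {b /\<^sub>R norm b}"
    using span_image_scale[of "{b}" "\<lambda>_. inverse (norm b)"] \<open>b \<noteq> 0\<close> by simp
  finally show ?thesis using that[of "b /\<^sub>R norm b"] \<open>b \<noteq> 0\<close> by simp
qed

lemma span_in_G21: "norm u = 1 \<Longrightarrow> span {u} \<in> G21"
  for u :: "real^2"
  by (auto simp: G21_def dim_span dim_singleton)

lemma unit_in_span_iff:
  fixes u v :: "real^2"
  assumes "norm u = 1"
  shows "v \<in> span {u} \<and> norm v = 1 \<longleftrightarrow> v = u \<or> v = - u"
proof
  assume v: "v \<in> span {u} \<and> norm v = 1"
  then obtain k where "v = k *\<^sub>R u" by (auto simp: span_singleton)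
  with v assms have "\<bar>k\<bar> = 1" by simp
  with \<open>v = k *\<^sub>R u\<close> show "v = u \<or> v = - u" by (auto simp: abs_if split: if_splits)
qed (use assms in \<open>auto simp: span_base span_neg\<close>)

lemma line_angle_span:
  assumes "norm u = 1" "norm v = 1"
  shows "line_angle (span {u}) (span {v}) = arccos \<bar>u \<bullet> v\<bar>"
proof -
  have *: "\<bar>u \<bullet> v\<bar> \<le> 1" using Cauchy_Schwarz_ineq2[of u v] assms by simp
  have "{arccos (a \<bullet> b) | a b. a \<in> span {u} \<and> b \<in> span {v} \<and> norm a = 1 \<and> norm b = 1}
      = {arccos (a \<bullet> b) | a b. (a = u \<or> a = - u) \<and> (b = v \<or> b = - v)}"
    using unit_in_span_iff[OF assms(1)] unit_in_span_iff[OF assms(2)] by blast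
  also have "\<dots> = {arccos (u \<bullet> v), arccos (- (u \<bullet> v))}"
    by (auto intro: exI[of _ u] exI[of _ v]) (metis inner_minus_right)
  finally have "line_angle (span {u}) (span {v}) = min (arccos (u \<bullet> v)) (arccos (- (u \<bullet> v)))"
    by (simp add: line_angle_def cInf_eq_Min span_in_G21 assms)
  also have "\<dots> = arccos \<bar>u \<bullet> v\<bar>"
    using * arccos_le_mono[of "u \<bullet> v" "-(u \<bullet> v)"] by (auto simp: min_def abs_if)
  finally show ?thesis .
qed

lemma arccos_abs_cos_le: "arccos \<bar>cos t\<bar> \<le> \<bar>t\<bar>"
proof (cases "\<bar>t\<bar> \<le> pi / 2")
  case True
  then have "cos t \<ge> 0" by (intro cos_ge_zero) auto
  moreover have "arccos (cos t) = \<bar>t\<bar>"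
    using True pi_gt_zero by (metis arccos_cos_eq_abs order_trans pi_half_le_two pi_half_ge_zero
        abs_ge_zero field_sum_of_halves le_add_same_cancel1)
  ultimately show ?thesis by simp
next
  case False
  have "arccos \<bar>cos t\<bar> \<le> pi / 2"
    using arccos_le_mono[of "\<bar>cos t\<bar>" 0] by simp
  with False show ?thesis by linarith
qed

lemma unit_polar:
  fixes u :: "real^2"
  assumes "norm u = 1"
  obtains t where "u $ 1 = cos t" "u $ 2 = sin t"
proof -
  have "(u $ 1)\<^sup>2 + (u $ 2)\<^sup>2 = 1"
    using assms by (simp add: norm_vec_def L2_set_def sum_2)
  then show ?thesis using sincos_total_2pi that by metis
qed

lemma arccos_abs_cos_triangle: "arccos \<bar>cos (s + t)\<bar> \<le> arccos \<bar>cos s\<bar> + arccos \<bar>cos t\<bar>"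
proof -
  define a where "a = arccos \<bar>cos s\<bar>"
  define b where "b = arccos \<bar>cos t\<bar>"
  have ca: "cos a = \<bar>cos s\<bar>" "cos b = \<bar>cos t\<bar>" by (auto simp: a_def b_def)
  have sa: "sin a = \<bar>sin s\<bar>" "sin b = \<bar>sin t\<bar>"
    by (simp_all add: a_def b_def sin_arccos_abs sin_squared_eq[symmetric])
  have "\<bar>cos (a + b)\<bar> \<le> \<bar>cos (s + t)\<bar>"
    using abs_triangle_ineq3[of "cos s * cos t" "sin s * sin t"]
    by (simp only: cos_add ca sa flip: abs_mult)
  then have "arccos \<bar>cos (s + t)\<bar> \<le> arccos \<bar>cos (a + b)\<bar>"
    by (intro arccos_le_arccos) auto
  also have "\<dots> \<le> \<bar>a + b\<bar>" by (rule arccos_abs_cos_le)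
  also have "\<dots> = a + b" by (simp add: a_def b_def arccos_lbound)
  finally show ?thesis by (simp add: a_def b_def)
qed

interpretation G21: Metric_space G21 line_angle
proof
  fix V W :: "(real^2) set"
  show "0 \<le> line_angle V W"
  proof (cases "V \<in> G21 \<and> W \<in> G21")
    case True
    then obtain u v where uv: "norm u = 1" "V = span {u}" "norm v = 1" "W = span {v}"
      by (elim conjE G21_obtain) blast
    then have "\<bar>u \<bullet> v\<bar> \<le> 1" using Cauchy_Schwarz_ineq2[of u v] by simp
    with uv show ?thesis by (simp add: line_angle_span arccos_lbound)
  qed (auto simp: line_angle_def)
  show "line_angle V W = line_angle W V"
  proof (cases "V \<in> G21 \<and> W \<in> G21")
    case True
    then obtain u v where uv: "norm u = 1" "V = span {u}" "norm v = 1" "W = span {v}"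
      by (elim conjE G21_obtain) blast
    then show ?thesis by (simp add: line_angle_span inner_commute)
  qed (auto simp: line_angle_def)
next
  fix V W assume "V \<in> G21" "W \<in> G21"
  then obtain u v where uv: "norm u = 1" "V = span {u}" "norm v = 1" "W = span {v}"
    by (elim G21_obtain) blast
  have le: "\<bar>u \<bullet> v\<bar> \<le> 1" using Cauchy_Schwarz_ineq2[of u v] uv by simp
  have "line_angle V W = 0 \<longleftrightarrow> \<bar>u \<bullet> v\<bar> = 1"
  proof -
    have "arccos \<bar>u \<bullet> v\<bar> = 0 \<longleftrightarrow> \<bar>u \<bullet> v\<bar> = 1"
    proof
      assume "arccos \<bar>u \<bullet> v\<bar> = 0"
      then have "cos (arccos \<bar>u \<bullet> v\<bar>) = 1" by simp
      then show "\<bar>u \<bullet> v\<bar> = 1" using le by (simp add: cos_arccos_abs)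
    qed simp
    then show ?thesis using uv by (simp add: line_angle_span)
  qed
  also have "\<dots> \<longleftrightarrow> u = v \<or> u = - v"
    using uv norm_cauchy_schwarz_abs_eq[of u v] by auto
  also have "\<dots> \<longleftrightarrow> u \<in> span {v}"
    using unit_in_span_iff[of v u] uv by auto
  also have "\<dots> \<longleftrightarrow> V = W"
  proof
    assume "u \<in> span {v}"
    then have "u = v \<or> u = - v" using unit_in_span_iff[of v u] uv by auto
    moreover have "span {- v} = span {v}"
      using span_image_scale[of "{v}" "\<lambda>_. - 1"] by simp
    ultimately show "V = W" using uv by auto
  next
    assume "V = W"
    then show "u \<in> span {v}" using uv span_base[of u "{u}"] by simp
  qed
  finally show "line_angle V W = 0 \<longleftrightarrow> V = W" .
next
  fix U V W assume *: "U \<in> G21" "V \<in> G21" "W \<in> G21"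
  obtain u where u: "norm u = 1" "U = span {u}" using G21_obtain[OF *(1)] .
  obtain v where v: "norm v = 1" "V = span {v}" using G21_obtain[OF *(2)] .
  obtain w where w: "norm w = 1" "W = span {w}" using G21_obtain[OF *(3)] .
  obtain r where r: "u $ 1 = cos r" "u $ 2 = sin r" using unit_polar[OF u(1)] .
  obtain s where s: "v $ 1 = cos s" "v $ 2 = sin s" using unit_polar[OF v(1)] .
  obtain t where t: "w $ 1 = cos t" "w $ 2 = sin t" using unit_polar[OF w(1)] .
  have "u \<bullet> v = cos (r - s)" "v \<bullet> w = cos (s - t)" "u \<bullet> w = cos ((r - s) + (s - t))"
    by (simp_all add: inner_vec_def sum_2 r s t cos_diff)
  with u v w show "line_angle U W \<le> line_angle U V + line_angle V W"
    using arccos_abs_cos_triangle[of "r - s" "s - t"] by (simp add: line_angle_span)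
qed

lemma orth_proj_span:
  assumes "norm u = 1"
  shows "orth_proj (span {u}) x = (x \<bullet> u) *\<^sub>R u"
  unfolding orth_proj_def
proof (rule the_equality)
  have uu: "u \<bullet> u = 1" using assms by (simp add: norm_eq_1)
  show "(x \<bullet> u) *\<^sub>R u \<in> span {u} \<and> (\<forall>w\<in>span {u}. (x - (x \<bullet> u) *\<^sub>R u) \<bullet> w = 0)"
    by (auto simp: span_singleton inner_diff_left uu)
  fix y assume y: "y \<in> span {u} \<and> (\<forall>w\<in>span {u}. (x - y) \<bullet> w = 0)"
  then obtain k where k: "y = k *\<^sub>R u" by (auto simp: span_singleton)
  have "(x - y) \<bullet> u = 0" using y by (auto simp: span_base)
  then show "y = (x \<bullet> u) *\<^sub>R u" by (simp add: k inner_diff_left uu)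
qed

lemma line_coord:
  assumes "V \<in> G21"
  shows "linear (line_coord V)" "\<And>v. v \<in> V \<Longrightarrow> norm (line_coord V v) = norm v"
proof -
  obtain u where u: "norm u = 1" "V = span {u}" using assms by (rule G21_obtain)
  then have uu: "u \<bullet> u = 1" by (simp add: norm_eq_1)
  have "linear (\<lambda>v. v \<bullet> u) \<and> (\<forall>v\<in>V. norm (v \<bullet> u) = norm v)"
    using u uu by (auto simp: span_singleton intro!: bounded_linear.linear bounded_linear_inner_left)
  then have "linear (line_coord V) \<and> (\<forall>v\<in>V. norm (line_coord V v) = norm v)"
    unfolding line_coord_def
    by (rule someI[where P = "\<lambda>f. linear f \<and> (\<forall>v\<in>V. norm (f v) = norm v)"])
  then show "linear (line_coord V)" "\<And>v. v \<in> V \<Longrightarrow> norm (line_coord V v) = norm v" by auto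
qed

end

theory Submission
  imports Defs
begin

text \<open>
  Fix a scale \<open>R\<close>, put \<open>\<delta> = R powr (1 / \<theta>)\<close>, and let \<open>P\<close> be the \<open>\<delta>\<close>-covering number of \<open>X\<close>
  and \<open>K\<close> a bound for that of \<open>X \<inter> B(x, R)\<close>.  If the projection to \<open>V\<close> is bad at
  this scale, some strip of width \<open>R\<close> orthogonal to \<open>V\<close> contains \<open>N\<close> points of \<open>X\<close> with
  \<open>\<delta>\<close>-separated projections, which are recorded injectively in a fixed \<open>\<delta>\<close>-net \<open>S\<close> of \<open>X\<close>
  with \<open>P\<close> points.  Strips for two lines at angle \<open>\<rho>\<close> meet in a set that is covered by
  \<open>O(1 / \<rho>)\<close> balls of radius \<open>R\<close>, so the two recorded sets share only \<open>O(K / \<rho>)\<close> points of \<open>S\<close>.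
  The decisive choice is to bin the bad lines at the single angular scale \<open>h = K / N\<close>:
  by Cauchy--Schwarz the number \<open>M\<close> of bins that are hit satisfies \<open>M N \<le> C P log(1 / \<delta>)\<close>, hence
  \<open>M h^\<alpha> \<le> C P K^\<alpha> N^(-1-\<alpha>) log(1 / \<delta>)\<close>.  Above the threshold of the theorem this is
  summable over dyadic \<open>R\<close>, so the lines that are bad at infinitely many scales form a
  null set for the \<open>\<alpha>\<close>-dimensional Hausdorff measure.
\<close>

section \<open>Covering numbers and dimensions\<close>

text \<open>Compactness of the closure supplies at least one finite cover, so the
  \<open>LEAST\<close> defining \<open>covering_number\<close> is attained by an actual set of
  centres.\<close>

lemma covering_number_exists:
  assumes "bounded A" "r > 0"
  obtains C where "finite C" "card C = covering_number r A" "A \<subseteq> (\<Union>c\<in>C. cball c r)"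
proof -
  have "compact (closure A)" using assms by simp
  then obtain C where C: "finite C" "closure A \<subseteq> (\<Union>c\<in>C. ball c r)"
    using compactE_image[of "closure A" "closure A" "\<lambda>c. ball c r"] assms(2)
    by (metis UN_I centre_in_ball open_ball subsetI)
  have "(\<Union>c\<in>C. ball c r) \<subseteq> (\<Union>c\<in>C. cball c r)" by (auto simp: less_imp_le)
  then have "A \<subseteq> (\<Union>c\<in>C. cball c r)" using C(2) closure_subset[of A] by (meson order_trans)
  then have "\<exists>n. \<exists>C. finite C \<and> card C = n \<and> A \<subseteq> (\<Union>c\<in>C. cball c r)" using C(1) by blast
  from LeastI_ex[OF this] show ?thesis using that unfolding covering_number_def by blast
qed

lemma covering_number_le:
  assumes "finite C" "A \<subseteq> (\<Union>c\<in>C. cball c r)"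
  shows "covering_number r A \<le> card C"
  unfolding covering_number_def using assms by (intro Least_le) blast

text \<open>Centres need not lie in the set they cover, so a cover of the larger set serves the
  smaller one unchanged.\<close>

lemma covering_number_mono:
  assumes "bounded B" "A \<subseteq> B" "0 < r" "r \<le> r'"
  shows "covering_number r' A \<le> covering_number r B"
proof -
  obtain C where C: "finite C" "card C = covering_number r B" "B \<subseteq> (\<Union>c\<in>C. cball c r)"
    using covering_number_exists[OF assms(1,3)] .
  have "(\<Union>c\<in>C. cball c r) \<subseteq> (\<Union>c\<in>C. cball c r')" using assms(4) by auto
  then have "A \<subseteq> (\<Union>c\<in>C. cball c r')" using C(3) assms(2) by (meson order_trans)
  from covering_number_le[OF C(1) this] show ?thesis using C(2) by simp
qed

lemma covering_number_pos:
  assumes "bounded A" "A \<noteq> {}" "0 < r"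
  shows "covering_number r A \<ge> 1"
proof -
  obtain C where C: "finite C" "card C = covering_number r A" "A \<subseteq> (\<Union>c\<in>C. cball c r)"
    using covering_number_exists[OF assms(1,3)] .
  then have "C \<noteq> {}" using assms by auto
  then show ?thesis using C(1,2) by (metis One_nat_def Suc_leI card_gt_0_iff)
qed

text \<open>A closed ball of radius \<open>r\<close> has diameter at most \<open>2 * r\<close>. As
  the separation is strict, each ball of a cover holds at most one point of
  \<open>Y\<close>.\<close>

lemma separated_card_le:
  assumes "bounded A" "0 < r" "finite Y" "Y \<subseteq> A"
    and sep: "\<And>x y. x \<in> Y \<Longrightarrow> y \<in> Y \<Longrightarrow> x \<noteq> y \<Longrightarrow> dist x y > 2 * r"
  shows "card Y \<le> covering_number r A"
proof -
  obtain C where C: "finite C" "card C = covering_number r A" "A \<subseteq> (\<Union>c\<in>C. cball c r)"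
    using covering_number_exists[OF assms(1,2)] .
  have "\<forall>y\<in>Y. \<exists>c\<in>C. dist c y \<le> r" using C(3) assms(4) by fastforce
  then obtain f where f: "\<And>y. y \<in> Y \<Longrightarrow> f y \<in> C \<and> dist (f y) y \<le> r" by metis
  have "inj_on f Y"
  proof (rule inj_onI, rule ccontr)
    fix x y assume *: "x \<in> Y" "y \<in> Y" "f x = f y" "x \<noteq> y"
    have "dist x y \<le> dist (f x) x + dist (f y) y"
      using *(3) by (metis dist_commute dist_triangle)
    then show False using f[OF *(1)] f[OF *(2)] sep[OF *(1,2,4)] by linarith
  qed
  then show ?thesis using card_inj_on_le[of f Y C] f C by (auto simp: image_subset_iff)
qed

text \<open>By \<open>separated_card_le\<close> a separated set of largest cardinality exists, and
  maximality makes it a \<open>2 * r\<close>-net. On the line an interval of radius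
  \<open>2 * r\<close> splits into two of radius \<open>r\<close>, which is the source of the factor
  2.\<close>

lemma max_separated_real:
  fixes A :: "real set"
  assumes "bounded A" "0 < r"
  obtains Z where "finite Z" "Z \<subseteq> A" "\<And>x y. x \<in> Z \<Longrightarrow> y \<in> Z \<Longrightarrow> x \<noteq> y \<Longrightarrow> dist x y > 2 * r"
    "covering_number r A \<le> 2 * card Z"
proof -
  define P where "P Z \<longleftrightarrow> finite Z \<and> Z \<subseteq> A \<and> (\<forall>x\<in>Z. \<forall>y\<in>Z. x \<noteq> y \<longrightarrow> dist x y > 2 * r)" for Z
  have "P {}" by (simp add: P_def)
  moreover have "\<forall>Z. P Z \<longrightarrow> card Z < Suc (covering_number r A)"
    using separated_card_le[OF assms] by (auto simp: P_def less_Suc_eq_le)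
  ultimately obtain Z where Z: "P Z" "\<And>Z'. P Z' \<Longrightarrow> card Z' \<le> card Z"
    using ex_has_greatest_nat[of P "{}" card "Suc (covering_number r A)"] by blast
  have fin: "finite Z" using Z(1) by (simp add: P_def)
  have near: "\<exists>z\<in>Z. dist z a \<le> 2 * r" if a: "a \<in> A" for a
  proof (rule ccontr)
    assume n: "\<not> (\<exists>z\<in>Z. dist z a \<le> 2 * r)"
    then have "a \<notin> Z" using assms by auto
    moreover have "P (insert a Z)" using Z(1) n a by (auto simp: P_def dist_commute not_le)
    ultimately show False using Z(2)[of "insert a Z"] fin by simp
  qed
  define C where "C = (\<lambda>z. z - r) ` Z \<union> (\<lambda>z. z + r) ` Z"
  have "A \<subseteq> (\<Union>c\<in>C. cball c r)"
  proof
    fix a assume "a \<in> A"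
    from near[OF this] obtain z where z: "z \<in> Z" "dist z a \<le> 2 * r" by blast
    then have "a \<in> cball (z - r) r \<or> a \<in> cball (z + r) r"
      by (auto simp: dist_real_def)
    then show "a \<in> (\<Union>c\<in>C. cball c r)" using z(1) by (auto simp: C_def)
  qed
  then have "covering_number r A \<le> card C" using fin by (intro covering_number_le) (auto simp: C_def)
  also have "\<dots> \<le> card ((\<lambda>z. z - r) ` Z) + card ((\<lambda>z. z + r) ` Z)"
    unfolding C_def by (rule card_Un_le)
  also have "\<dots> \<le> 2 * card Z" using card_image_le[OF fin] by (metis add_mono mult_2)
  finally show ?thesis using that Z(1) by (auto simp: P_def)
qed

section \<open>Power bounds extracted from the two dimensions\<close>

lemma upper_box_dim_nonneg:
  assumes "bounded X"
  shows "0 \<le> upper_box_dim X"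
proof (cases "X = {}")
  case False
  have "eventually (\<lambda>r::real. 0 < r \<and> r < 1) (at_right 0)"
    by (auto simp: eventually_at_right_field intro: exI[of _ 1])
  then have "eventually (\<lambda>r::real. 0 \<le> ereal (ln (real (covering_number r X)) / (- ln r))) (at_right 0)"
  proof eventually_elim
    case (elim r)
    then show ?case using covering_number_pos[OF assms False, of r]
      by (auto intro!: divide_nonneg_neg simp: zero_ereal_def)
  qed
  then have "Limsup (at_right 0) (\<lambda>r::real. 0 :: ereal)
      \<le> Limsup (at_right 0) (\<lambda>r::real. ereal (ln (real (covering_number r X)) / (- ln r)))"
    by (rule Limsup_mono)
  then show ?thesis using False by (simp add: upper_box_dim_def Limsup_const)
qed (simp add: upper_box_dim_def)

text \<open>The limsup controls only radii below some \<open>e\<close>; for the remaining radii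
  below 1 monotonicity gives a constant, and \<open>r powr (- b)\<close> is at least 1
  there.\<close>

lemma covering_number_le_of_upper_box_dim:
  fixes X :: "'a::euclidean_space set"
  assumes "bounded X" "upper_box_dim X < ereal b"
  obtains C where "C > 0" "\<And>r. 0 < r \<Longrightarrow> r < 1 \<Longrightarrow> real (covering_number r X) \<le> C * r powr (- b)"
proof (cases "X = {}")
  case True
  have "covering_number r X = 0" for r using covering_number_le[of "{}" X r] True by simp
  then show ?thesis using that[of 1] by simp
next
  case False
  have b: "b \<ge> 0" using upper_box_dim_nonneg[OF assms(1)] assms(2)
    by (metis ereal_less_eq(5) less_imp_le order_trans)
  have "Limsup (at_right 0) (\<lambda>r::real. ereal (ln (real (covering_number r X)) / (- ln r))) < ereal b"
    using assms False by (simp add: upper_box_dim_def)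
  from Limsup_lessD[OF this]
  obtain e where e: "e > 0" "\<And>r::real. 0 < r \<Longrightarrow> r < e \<Longrightarrow> ln (real (covering_number r X)) / (- ln r) < b"
    by (auto simp: eventually_at_right_field)
  \<comment> \<open>This radius lies below every \<open>r\<close> that is not below
    \<open>e\<close>, so \<open>c\<close> bounds all covering numbers in that range.\<close>
  define c where "c = real (covering_number (min e 1 / 2) X)"
  have c: "c \<ge> 1" unfolding c_def using covering_number_pos[OF assms(1) False, of "min e 1 / 2"] e(1) by simp
  show ?thesis
  proof (rule that[of c])
    fix r :: real assume r: "0 < r" "r < 1"
    have p: "r powr (- b) \<ge> 1" using r b by (simp add: powr_minus one_le_inverse_iff powr_le1)
    show "real (covering_number r X) \<le> c * r powr (- b)"
    proof (cases "r < e")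
      case True
      have pos: "real (covering_number r X) \<ge> 1" using covering_number_pos[OF assms(1) False r(1)] by simp
      have "ln (real (covering_number r X)) < b * (- ln r)"
        using e(2)[OF r(1) True] r by (subst (asm) pos_divide_less_eq) auto
      then have "real (covering_number r X) \<le> exp (b * (- ln r))"
        using pos by (metis exp_le_cancel_iff exp_ln less_eq_real_def order_less_le_trans zero_less_one)
      also have "\<dots> = r powr (- b)" using r by (simp add: powr_def)
      also have "\<dots> \<le> c * r powr (- b)" using mult_right_mono[OF c, of "r powr (- b)"] by simp
      finally show ?thesis .
    next
      case f: False
      have "real (covering_number r X) \<le> c" unfolding c_def
        using covering_number_mono[OF assms(1) order_refl, of "min e 1 / 2" r] e(1) f by simp
      also have "\<dots> \<le> c * r powr (- b)" using mult_left_mono[OF p, of c] c by simp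
      finally show ?thesis .
    qed
  qed (use c in simp)
qed

lemma assouad_spectrum_nonneg: "0 \<le> assouad_spectrum \<theta> X"
  unfolding assouad_spectrum_def by (auto intro!: INF_greatest)

text \<open>Since \<open>1 / \<theta>\<close> exceeds 1, the covering radius is at most
  \<open>R\<close>. Hence raising the exponent of the ratio only weakens a covering bound.\<close>

lemma scale_ratio_ge_1:
  fixes R :: real
  assumes "0 < \<theta>" "\<theta> < 1" "0 < R" "R < 1"
  shows "R / R powr (1 / \<theta>) \<ge> 1"
proof -
  have "R powr (1 / \<theta>) \<le> R powr 1"
    using assms by (intro powr_mono') (auto simp: field_simps simp del: powr_one)
  then show ?thesis using assms by (simp add: field_simps)
qed

text \<open>The infimum need not be attained, but some admissible exponent lies below
  \<open>a\<close>, and the base of the power is at least 1.\<close>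

lemma covering_number_le_of_assouad_spectrum:
  assumes "0 < \<theta>" "\<theta> < 1" "assouad_spectrum \<theta> X < ereal a"
  obtains C where "C > 0" "\<And>R x. 0 < R \<Longrightarrow> R < 1 \<Longrightarrow> x \<in> X \<Longrightarrow>
    real (covering_number (R powr (1 / \<theta>)) (X \<inter> cball x R)) \<le> C * (R / R powr (1 / \<theta>)) powr a"
proof -
  from assms(3) obtain a' C where a': "a' < a" "C > 0" and
    C: "\<And>R x. 0 < R \<Longrightarrow> R < 1 \<Longrightarrow> x \<in> X \<Longrightarrow>
    real (covering_number (R powr (1 / \<theta>)) (X \<inter> cball x R)) \<le> C * (R / R powr (1 / \<theta>)) powr a'"
    unfolding assouad_spectrum_def INF_less_iff by auto
  show ?thesis
  proof (rule that[OF a'(2)])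
    fix R :: real and x assume R: "0 < R" "R < 1" "x \<in> X"
    have "(R / R powr (1 / \<theta>)) powr a' \<le> (R / R powr (1 / \<theta>)) powr a"
      using a' scale_ratio_ge_1[OF assms(1,2) R(1,2)] by (intro powr_mono) auto
    then show "real (covering_number (R powr (1 / \<theta>)) (X \<inter> cball x R)) \<le> C * (R / R powr (1 / \<theta>)) powr a"
      using C[OF R] a'(2) by (meson mult_left_mono less_imp_le order_trans)
  qed
qed

lemma assouad_spectrum_le:
  assumes "0 \<le> a" "C > 0" "\<And>R x. 0 < R \<Longrightarrow> R < 1 \<Longrightarrow> x \<in> X \<Longrightarrow>
    real (covering_number (R powr (1 / \<theta>)) (X \<inter> cball x R)) \<le> C * (R / R powr (1 / \<theta>)) powr a"
  shows "assouad_spectrum \<theta> X \<le> ereal a"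
  unfolding assouad_spectrum_def using assms by (intro INF_lower) auto

text \<open>Bound local covering numbers by global ones: with
  \<open>r = R powr (1 / \<theta>)\<close> the ratio \<open>R / r\<close> is
  \<open>r powr (\<theta> - 1)\<close>, so its power \<open>b / (1 - \<theta>)\<close> is exactly
  \<open>r powr (- b)\<close>. This yields finiteness of the spectrum.\<close>

lemma assouad_spectrum_le_of_upper_box_dim:
  assumes "bounded X" "0 < \<theta>" "\<theta> < 1" "upper_box_dim X < ereal b"
  shows "assouad_spectrum \<theta> X \<le> ereal (b / (1 - \<theta>))"
proof -
  obtain C where C: "C > 0" "\<And>r. 0 < r \<Longrightarrow> r < 1 \<Longrightarrow> real (covering_number r X) \<le> C * r powr (- b)"
    using covering_number_le_of_upper_box_dim[OF assms(1,4)] by blast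
  have b: "b \<ge> 0" using upper_box_dim_nonneg[OF assms(1)] assms(4)
    by (metis ereal_less_eq(5) less_imp_le order_trans)
  show ?thesis
  proof (rule assouad_spectrum_le[OF _ C(1)])
    fix R :: real and x assume R: "0 < R" "R < 1" "x \<in> X"
    define r where "r = R powr (1 / \<theta>)"
    have r: "0 < r" "r < 1" using R assms powr_less_mono2[of "1 / \<theta>" R 1] by (auto simp: r_def)
    have "R / r = R powr (1 - 1 / \<theta>)" using R by (simp add: r_def powr_diff)
    then have "(R / r) powr (b / (1 - \<theta>)) = R powr ((1 - 1 / \<theta>) * (b / (1 - \<theta>)))"
      by (simp add: powr_powr)
    also have "(1 - 1 / \<theta>) * (b / (1 - \<theta>)) = 1 / \<theta> * (- b)" using assms(2,3) by (simp add: field_simps)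
    also have "R powr \<dots> = r powr (- b)" unfolding r_def powr_powr ..
    finally have "(R / r) powr (b / (1 - \<theta>)) = r powr (- b)" .
    moreover have "covering_number r (X \<inter> cball x R) \<le> covering_number r X"
      using covering_number_mono[OF assms(1), of "X \<inter> cball x R" r r] r by simp
    ultimately show "real (covering_number (R powr (1 / \<theta>)) (X \<inter> cball x R))
        \<le> C * (R / R powr (1 / \<theta>)) powr (b / (1 - \<theta>))"
      using C(2)[OF r] by (simp flip: r_def)
  qed (use b assms in auto)
qed

section \<open>Null sets of Hausdorff measures\<close>

context Metric_space
begin

text \<open>One \<open>e\<close> limits both the mesh and the total, so for null sets the supremum
  over meshes and the infimum over covers merge into a single quantifier.\<close>

definition small_cover :: "real \<Rightarrow> real \<Rightarrow> 'a set \<Rightarrow> bool" where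
  "small_cover s e A \<longleftrightarrow> (\<exists>U :: nat \<Rightarrow> 'a set. A \<subseteq> (\<Union>i. U i) \<and>
     (\<forall>i. U i \<subseteq> M \<and> ediam (U i) \<le> ennreal e) \<and> (\<Sum>i. diam_pow s (U i)) \<le> ennreal e)"

lemma hausdorff_measure_eq_0_iff_small_cover:
  "hausdorff_measure s A = 0 \<longleftrightarrow> (\<forall>e>0. small_cover s e A)"
proof
  assume h: "hausdorff_measure s A = 0"
  show "\<forall>e>0. small_cover s e A"
  proof (intro allI impI)
    fix e :: real assume e: "e > 0"
    have "hausdorff_premeasure s e A \<le> hausdorff_measure s A"
      unfolding hausdorff_measure_def using e by (intro SUP_upper) auto
    then have "hausdorff_premeasure s e A < ennreal e" using h e by simp
    then obtain U where "A \<subseteq> (\<Union>i. U i)" "\<forall>i. U i \<subseteq> M \<and> ediam (U i) \<le> ennreal e"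
      "(\<Sum>i. diam_pow s (U i)) < ennreal e"
      unfolding hausdorff_premeasure_def INF_less_iff by blast
    then show "small_cover s e A" unfolding small_cover_def using less_imp_le by blast
  qed
next
  assume sc: "\<forall>e>0. small_cover s e A"
  have "hausdorff_premeasure s \<delta> A = 0" if "\<delta> > 0" for \<delta>
  proof -
    have "hausdorff_premeasure s \<delta> A \<le> 0 + ennreal e" if e: "e > 0" for e
    proof -
      \<comment> \<open>The minimum keeps the cover admissible for mesh \<open>\<delta>\<close>
        while its sum stays below \<open>e\<close>.\<close>
      have "small_cover s (min \<delta> e) A" using sc e \<open>\<delta> > 0\<close> by simp
      then obtain U where U: "A \<subseteq> (\<Union>i. U i)" "\<And>i. U i \<subseteq> M" "\<And>i. ediam (U i) \<le> ennreal (min \<delta> e)"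
        "(\<Sum>i. diam_pow s (U i)) \<le> ennreal (min \<delta> e)"
        unfolding small_cover_def by blast
      have "ediam (U i) \<le> ennreal \<delta>" for i
        using U(3)[of i] by (rule order_trans) (simp add: ennreal_leI)
      then have "hausdorff_premeasure s \<delta> A \<le> (\<Sum>i. diam_pow s (U i))"
        unfolding hausdorff_premeasure_def using U by (intro INF_lower) auto
      also have "\<dots> \<le> ennreal (min \<delta> e)" by (rule U(4))
      also have "\<dots> \<le> 0 + ennreal e" by (simp add: ennreal_leI)
      finally show ?thesis .
    qed
    then have "hausdorff_premeasure s \<delta> A \<le> 0"
      by (rule ennreal_le_epsilon)
    then show ?thesis by simp
  qed
  then show "hausdorff_measure s A = 0" by (simp add: hausdorff_measure_def)
qed

lemma hausdorff_measure_eq_0_mono: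
  assumes "hausdorff_measure s B = 0" "A \<subseteq> B"
  shows "hausdorff_measure s A = 0"
  using assms unfolding hausdorff_measure_eq_0_iff_small_cover small_cover_def
  by (meson subset_trans)

text \<open>The pairing function flattens a doubly indexed cover into a sequence; sums in
  \<open>ennreal\<close> may be rearranged freely.\<close>

lemma small_coverI_pairs:
  fixes W :: "nat \<Rightarrow> nat \<Rightarrow> 'a set"
  assumes "A \<subseteq> (\<Union>i j. W i j)" "\<And>i j. W i j \<subseteq> M" "\<And>i j. ediam (W i j) \<le> ennreal e"
    and "(\<Sum>i. \<Sum>j. diam_pow s (W i j)) \<le> ennreal e"
  shows "small_cover s e A"
proof -
  define U where "U n = (case prod_decode n of (i, j) \<Rightarrow> W i j)" for n
  have W: "W i j = U (prod_encode (i, j))" for i j by (simp add: U_def)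
  have "A \<subseteq> (\<Union>n. U n)"
  proof
    fix x assume "x \<in> A"
    then obtain i j where "x \<in> W i j" using assms(1) by blast
    then show "x \<in> (\<Union>n. U n)" unfolding W by (rule UN_I[OF UNIV_I])
  qed
  moreover have "(\<Sum>n. diam_pow s (U n)) = (\<Sum>i. \<Sum>j. diam_pow s (W i j))"
    using suminf_ennreal_2dimen[of "\<lambda>i. \<Sum>j. diam_pow s (W i j)" "\<lambda>(i, j). diam_pow s (W i j)"]
    by (simp add: U_def comp_def case_prod_unfold)
  moreover have "U n \<subseteq> M \<and> ediam (U n) \<le> ennreal e" for n
    using assms(2,3) by (auto simp: U_def split: prod.splits)
  ultimately show ?thesis unfolding small_cover_def using assms(4) by (intro exI[of _ U]) simp
qed

text \<open>The \<open>i\<close>-th set receives the share \<open>e / 2 ^ Suc i\<close>, and the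
  shares add up to \<open>e\<close>.\<close>

lemma hausdorff_measure_UN_eq_0:
  fixes A :: "nat \<Rightarrow> 'a set"
  assumes "\<And>i. hausdorff_measure s (A i) = 0"
  shows "hausdorff_measure s (\<Union>i. A i) = 0"
  unfolding hausdorff_measure_eq_0_iff_small_cover
proof (intro allI impI)
  fix e :: real assume e: "e > 0"
  define \<epsilon> where "\<epsilon> i = e * (1 / 2) ^ Suc i" for i
  have \<epsilon>: "\<epsilon> i > 0" "\<epsilon> i \<le> e" for i
    using e by (auto simp: \<epsilon>_def mult_le_cancel_left1 power_le_one simp del: power_Suc)
  have "\<forall>i. small_cover s (\<epsilon> i) (A i)"
    using assms \<epsilon>(1) by (simp add: hausdorff_measure_eq_0_iff_small_cover)
  then have "\<forall>i. \<exists>U. A i \<subseteq> (\<Union>j. U j) \<and> (\<forall>j. U j \<subseteq> M \<and> ediam (U j) \<le> ennreal (\<epsilon> i))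
      \<and> (\<Sum>j. diam_pow s (U j)) \<le> ennreal (\<epsilon> i)"
    by (simp add: small_cover_def)
  from choice[OF this] obtain W where "\<forall>i. A i \<subseteq> (\<Union>j. W i j) \<and>
      (\<forall>j. W i j \<subseteq> M \<and> ediam (W i j) \<le> ennreal (\<epsilon> i)) \<and> (\<Sum>j. diam_pow s (W i j)) \<le> ennreal (\<epsilon> i)"
    by (rule exE)
  then have W: "\<And>i. A i \<subseteq> (\<Union>j. W i j)" "\<And>i j. W i j \<subseteq> M"
    "\<And>i j. ediam (W i j) \<le> ennreal (\<epsilon> i)" "\<And>i. (\<Sum>j. diam_pow s (W i j)) \<le> ennreal (\<epsilon> i)"
    by simp_all
  show "small_cover s e (\<Union>i. A i)"
  proof (rule small_coverI_pairs)
    show "(\<Union>i. A i) \<subseteq> (\<Union>i j. W i j)" by (intro UN_mono order_refl W)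
    show "ediam (W i j) \<le> ennreal e" for i j
      using W(3) by (rule order_trans) (simp add: ennreal_leI \<epsilon>)
    have "\<epsilon> sums e" unfolding \<epsilon>_def using sums_mult[OF power_half_series, of e] by simp
    then have "(\<Sum>i. ennreal (\<epsilon> i)) = ennreal e"
      using \<epsilon>(1) e by (intro suminf_ennreal_eq) (auto simp: less_imp_le)
    then show "(\<Sum>i. \<Sum>j. diam_pow s (W i j)) \<le> ennreal e"
      using suminf_le[of "\<lambda>i. \<Sum>j. diam_pow s (W i j)" "\<lambda>i. ennreal (\<epsilon> i)"] W(4) by simp
  qed (rule W)
qed

text \<open>At \<open>s = 0\<close> a nonempty set counts 1, which is matched by
  \<open>h powr 0 = 1\<close> because \<open>h\<close> is positive.\<close>

lemma diam_pow_le: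
  assumes "0 \<le> s" "0 < h" "ediam U \<le> ennreal h"
  shows "diam_pow s U \<le> ennreal (h powr s)"
proof -
  have "enn2real (ediam U) \<le> h" using assms(2,3) by (metis enn2real_leI less_imp_le)
  then show ?thesis using assms
    by (auto simp: diam_pow_def intro!: ennreal_leI powr_mono2)
qed

text \<open>A Borel-Cantelli argument: points lying in infinitely many \<open>F n\<close> are
  covered by every tail of the covers, and the content of a tail is at most a tail of a convergent
  series. That the diameters become small is not assumed but follows from summability.\<close>

lemma hausdorff_measure_limsup_eq_0:
  fixes F :: "nat \<Rightarrow> 'a set"
  assumes s: "0 \<le> s" and h: "\<And>n. 0 < h n" and a: "summable a"
    and cover: "\<And>n. \<exists>\<U>. finite \<U> \<and> F n \<subseteq> \<Union>\<U> \<and> (\<forall>U\<in>\<U>. U \<subseteq> M \<and> ediam U \<le> ennreal (h n))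
                 \<and> real (card \<U>) * h n powr s \<le> a n"
  shows "hausdorff_measure s {x. \<exists>\<^sub>\<infinity>n. x \<in> F n} = 0"
  unfolding hausdorff_measure_eq_0_iff_small_cover
proof (intro allI impI)
  fix e :: real assume e: "e > 0"
  obtain \<U> where "\<forall>n. finite (\<U> n) \<and> F n \<subseteq> \<Union>(\<U> n) \<and>
      (\<forall>U\<in>\<U> n. U \<subseteq> M \<and> ediam U \<le> ennreal (h n)) \<and> real (card (\<U> n)) * h n powr s \<le> a n"
    using choice[OF allI[OF cover]] by (rule exE)
  then have \<U>: "\<And>n. finite (\<U> n)" "\<And>n. F n \<subseteq> \<Union>(\<U> n)"
    "\<And>n U. U \<in> \<U> n \<Longrightarrow> U \<subseteq> M" "\<And>n U. U \<in> \<U> n \<Longrightarrow> ediam U \<le> ennreal (h n)"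
    "\<And>n. real (card (\<U> n)) * h n powr s \<le> a n"
    by simp_all
  have a0: "0 \<le> a n" for n using \<U>(5)[of n] by (rule order_trans[rotated]) simp
  \<comment> \<open>A nonempty cover has content at least \<open>h n powr s\<close>, so
    \<open>a n < e'\<close> forces \<open>h n \<le> e\<close>. For \<open>s = 0\<close> that content
    is at least 1, and the value 1 for \<open>e'\<close> then forces the cover to be empty.\<close>
  define e' where "e' = (if s = 0 then 1 else e powr s)"
  have e': "e' > 0" using e by (simp add: e'_def)
  have "eventually (\<lambda>n. a n < e') sequentially"
    using order_tendstoD(2)[OF summable_LIMSEQ_zero[OF a] e'] .
  moreover obtain N1 where N1: "\<And>n. n \<ge> N1 \<Longrightarrow> norm (\<Sum>i. a (i + n)) < e"
    using suminf_exist_split[OF e a] by blast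
  ultimately obtain N2 where N2: "\<And>n. n \<ge> N2 \<Longrightarrow> a n < e'"
    unfolding eventually_sequentially by blast
  define n0 where "n0 = max N1 N2"
  have n0: "n0 \<ge> N1" "\<And>n. n \<ge> n0 \<Longrightarrow> a n < e'" using N2 by (auto simp: n0_def)
  have hn: "h n \<le> e" if "n \<ge> n0" "\<U> n \<noteq> {}" for n
  proof -
    have c: "real (card (\<U> n)) \<ge> 1" using that \<U>(1)[of n] by (simp add: Suc_le_eq card_gt_0_iff)
    have "h n powr s \<le> real (card (\<U> n)) * h n powr s" using mult_right_mono[OF c, of "h n powr s"] by simp
    also have "\<dots> < e'" using \<U>(5)[of n] n0(2)[OF that(1)] by linarith
    finally have l: "h n powr s < e'" .
    then have s0: "s \<noteq> 0" using h[of n] by (auto simp: e'_def)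
    with l have "h n powr s < e powr s" by (simp add: e'_def)
    then show ?thesis using s powr_mono2[of s e "h n"] e by linarith
  qed
  have "\<forall>n. \<exists>f. bij_betw f {..<card (\<U> n)} (\<U> n)"
    using ex_bij_betw_nat_finite[OF \<U>(1)] by (simp add: atLeast0LessThan)
  from choice[OF this] obtain f where "\<forall>n. bij_betw (f n) {..<card (\<U> n)} (\<U> n)" by (rule exE)
  then have f: "\<And>n. bij_betw (f n) {..<card (\<U> n)} (\<U> n)" by simp
  \<comment> \<open>Padding each finite cover to a sequence is harmless: \<open>diam_pow\<close>
    gives the empty set 0 even for \<open>s = 0\<close>.\<close>
  define W where "W n k = (if k < card (\<U> (n + n0)) then f (n + n0) k else {})" for n k
  have fin: "f n k \<in> \<U> n" if "k < card (\<U> n)" for n k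
    using f[of n] that by (auto simp: bij_betw_def)
  show "small_cover s e {x. \<exists>\<^sub>\<infinity>n. x \<in> F n}"
  proof (rule small_coverI_pairs)
    show "{x. \<exists>\<^sub>\<infinity>n. x \<in> F n} \<subseteq> (\<Union>n k. W n k)"
    proof
      fix x assume "x \<in> {x. \<exists>\<^sub>\<infinity>n. x \<in> F n}"
      then obtain n where n: "n \<ge> n0" "x \<in> F n" by (auto simp: INFM_nat_le)
      then obtain U where U: "U \<in> \<U> n" "x \<in> U" using \<U>(2) by blast
      then obtain k where "k < card (\<U> n)" "f n k = U"
        using f[of n] by (metis bij_betw_imp_surj_on imageE lessThan_iff)
      then have "W (n - n0) k = U" using n by (simp add: W_def)
      then show "x \<in> (\<Union>n k. W n k)" using U by blast
    qed
    show "W n k \<subseteq> M" for n k using \<U>(3) fin by (auto simp: W_def)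
    show "ediam (W n k) \<le> ennreal e" for n k
    proof (cases "k < card (\<U> (n + n0))")
      case True
      have "ediam (f (n + n0) k) \<le> ennreal (h (n + n0))" using \<U>(4) fin[OF True] by blast
      also have "\<dots> \<le> ennreal e" using hn[of "n + n0"] fin[OF True] by (intro ennreal_leI) auto
      finally show ?thesis using True by (simp add: W_def)
    qed (simp add: W_def ediam_def)
    have "(\<Sum>k. diam_pow s (W n k)) \<le> ennreal (a (n + n0))" for n
    proof -
      have "(\<Sum>k. diam_pow s (W n k)) = (\<Sum>k<card (\<U> (n + n0)). diam_pow s (W n k))"
        by (rule suminf_finite) (auto simp: W_def diam_pow_def)
      also have "\<dots> \<le> (\<Sum>k<card (\<U> (n + n0)). ennreal (h (n + n0) powr s))"
        using \<U>(4) fin by (intro sum_mono diam_pow_le s h) (auto simp: W_def)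
      also have "\<dots> = ennreal (real (card (\<U> (n + n0))) * h (n + n0) powr s)"
        by (simp add: ennreal_mult ennreal_of_nat_eq_real_of_nat)
      also have "\<dots> \<le> ennreal (a (n + n0))" by (intro ennreal_leI \<U>)
      finally show ?thesis .
    qed
    then have "(\<Sum>n. \<Sum>k. diam_pow s (W n k)) \<le> (\<Sum>n. ennreal (a (n + n0)))"
      by (intro suminf_le) auto
    also have "\<dots> = ennreal (\<Sum>n. a (n + n0))"
      using a a0 by (intro suminf_ennreal2) (auto simp: summable_iff_shift)
    also have "\<dots> \<le> ennreal e" using N1[OF n0(1)] by (intro ennreal_leI) auto
    finally show "(\<Sum>n. \<Sum>k. diam_pow s (W n k)) \<le> ennreal e" .
  qed
qed

lemma hausdorff_dim_le:
  assumes "0 \<le> s" "hausdorff_measure s A = 0"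
  shows "hausdorff_dim A \<le> ereal s"
  unfolding hausdorff_dim_def using assms by (intro INF_lower) auto

end

section \<open>Counting in intersecting tubes\<close>

text \<open>A second-moment argument. The multiplicity \<open>cnt\<close> sums to
  \<open>card J * N\<close> over \<open>S\<close>, and its squares sum to all pairwise overlaps,
  whose rows are harmonic sums. Cauchy-Schwarz compares the two, after which one factor
  \<open>card J * N\<close> cancels.\<close>

lemma card_overlap_le:
  fixes E :: "nat \<Rightarrow> 'a set"
  assumes S: "finite S" and J: "J \<subseteq> {..m}" and N: "N > 0" and c: "c \<ge> 0"
    and E: "\<And>k. k \<in> J \<Longrightarrow> E k \<subseteq> S" "\<And>k. k \<in> J \<Longrightarrow> card (E k) = N"
    and ov: "\<And>k l. k \<in> J \<Longrightarrow> l \<in> J \<Longrightarrow> card (E k \<inter> E l) \<le> c * N / (1 + \<bar>real k - real l\<bar>)"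
  shows "real (card J) * N \<le> 2 * c * (2 + ln (1 + real m)) * card S"
proof (cases "J = {}")
  case False
  have finJ: "finite J" using J finite_subset by blast
  define cnt where "cnt x = (\<Sum>k\<in>J. indicator (E k) x :: real)" for x
  have fE: "finite (E k)" if "k \<in> J" for k using E(1)[OF that] S finite_subset by blast
  have cardE: "(\<Sum>x\<in>S. indicator (A) x :: real) = card A" if "A \<subseteq> S" for A
    using that S by (simp add: indicator_def sum.If_cases Int_absorb1)
  have s1: "(\<Sum>x\<in>S. cnt x) = real (card J) * N"
  proof -
    have "(\<Sum>x\<in>S. cnt x) = (\<Sum>k\<in>J. \<Sum>x\<in>S. indicator (E k) x)"
      unfolding cnt_def by (rule sum.swap)
    also have "\<dots> = (\<Sum>k\<in>J. real N)" by (intro sum.cong refl) (simp add: cardE E)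
    finally show ?thesis by simp
  qed
  define H :: real where "H = (\<Sum>i\<le>m. 1 / (1 + real i))"
  have H: "H \<le> 2 + ln (1 + real m)"
  proof -
    have "H = harm (Suc m)" unfolding H_def harm_def
      by (rule sum.reindex_bij_witness[of _ "\<lambda>i. i - 1" Suc]) (auto simp: inverse_eq_divide)
    also have "harm (Suc m) \<le> ln (Suc m) + 1"
    proof -
      \<comment> \<open>The difference of harmonic number and logarithm decreases, so it is at most
        its value 1 at the first index.\<close>
      have "harm (Suc m) - ln (real (Suc m)) \<le> harm (Suc 0) - ln (real (Suc 0))"
        using decseq_harm_diff_ln[unfolded decseq_def] by (metis le0)
      then show ?thesis by (simp add: harm_def)
    qed
    finally show ?thesis by (simp add: add.commute)
  qed
  \<comment> \<open>The row is split at \<open>l = k\<close>; each half is a piece of the harmonic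
    sum \<open>H\<close>, and counting the diagonal term twice does no harm.\<close>
  have row: "(\<Sum>l\<in>J. 1 / (1 + \<bar>real k - real l\<bar>)) \<le> 2 * H" if "k \<in> J" for k
  proof -
    have k: "k \<le> m" using that J by auto
    have "(\<Sum>l\<in>J. 1 / (1 + \<bar>real k - real l\<bar>)) \<le> (\<Sum>l\<le>m. 1 / (1 + \<bar>real k - real l\<bar>))"
      using J by (intro sum_mono2) auto
    also have "\<dots> \<le> (\<Sum>l\<in>{..k} \<union> {k..m}. 1 / (1 + \<bar>real k - real l\<bar>))"
      by (intro sum_mono2) auto
    also have "\<dots> \<le> (\<Sum>l\<in>{..k}. 1 / (1 + \<bar>real k - real l\<bar>)) + (\<Sum>l\<in>{k..m}. 1 / (1 + \<bar>real k - real l\<bar>))"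
      by (subst sum_Un) (auto intro!: sum_nonneg)
    also have "(\<Sum>l\<in>{..k}. 1 / (1 + \<bar>real k - real l\<bar>)) = (\<Sum>i\<le>k. 1 / (1 + real i))"
      by (rule sum.reindex_bij_witness[of _ "\<lambda>i. k - i" "\<lambda>i. k - i"]) auto
    also have "\<dots> \<le> H" unfolding H_def using k by (intro sum_mono2) auto
    also have "(\<Sum>l\<in>{k..m}. 1 / (1 + \<bar>real k - real l\<bar>)) = (\<Sum>i\<le>m - k. 1 / (1 + real i))"
      by (rule sum.reindex_bij_witness[of _ "\<lambda>i. k + i" "\<lambda>i. i - k"]) (use k in auto)
    also have "\<dots> \<le> H" unfolding H_def by (intro sum_mono2) auto
    finally show ?thesis by simp
  qed
  have s2: "(\<Sum>x\<in>S. (cnt x)\<^sup>2) \<le> real (card J) * (c * N * (2 * H))"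
  proof -
    have "(\<Sum>x\<in>S. (cnt x)\<^sup>2) = (\<Sum>x\<in>S. \<Sum>k\<in>J. \<Sum>l\<in>J. indicator (E k \<inter> E l) x)"
      by (simp add: cnt_def power2_eq_square sum_product indicator_inter_arith)
    also have "\<dots> = (\<Sum>k\<in>J. \<Sum>x\<in>S. \<Sum>l\<in>J. indicator (E k \<inter> E l) x)" by (rule sum.swap)
    also have "\<dots> = (\<Sum>k\<in>J. \<Sum>l\<in>J. \<Sum>x\<in>S. indicator (E k \<inter> E l) x)"
      by (intro sum.cong refl sum.swap)
    also have "\<dots> = (\<Sum>k\<in>J. \<Sum>l\<in>J. real (card (E k \<inter> E l)))"
      by (intro sum.cong refl cardE) (use E in blast)
    also have "\<dots> \<le> (\<Sum>k\<in>J. \<Sum>l\<in>J. c * N * (1 / (1 + \<bar>real k - real l\<bar>)))"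
      by (intro sum_mono) (use ov in simp)
    also have "\<dots> = (\<Sum>k\<in>J. c * N * (\<Sum>l\<in>J. 1 / (1 + \<bar>real k - real l\<bar>)))"
      by (simp add: sum_distrib_left)
    also have "\<dots> \<le> (\<Sum>k\<in>J. c * N * (2 * H))"
      using c by (intro sum_mono mult_left_mono row) auto
    finally show ?thesis by simp
  qed
  have "(\<Sum>x\<in>S. cnt x)\<^sup>2 \<le> (\<Sum>x\<in>S. (cnt x)\<^sup>2) * (\<Sum>x\<in>S. 1\<^sup>2)"
    using Cauchy_Schwarz_ineq_sum[of cnt "\<lambda>_. 1" S] by simp
  also have "\<dots> \<le> real (card J) * (c * N * (2 * H)) * card S"
    using s2 by (auto intro: mult_right_mono)
  finally have "(real (card J) * N) * (real (card J) * N) \<le> (real (card J) * N) * (2 * c * H * card S)"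
    by (simp add: s1 power2_eq_square mult_ac)
  moreover have "real (card J) * N > 0" using N False finJ by (simp add: card_gt_0_iff)
  ultimately have "real (card J) * N \<le> 2 * c * H * card S" by (metis mult_le_cancel_left_pos)
  also have "\<dots> \<le> 2 * c * (2 + ln (1 + real m)) * card S"
    using H c by (intro mult_right_mono mult_left_mono) auto
  finally show ?thesis .
qed (use c in simp)

lemma abs_real_of_int_le_eq: "{z::int. \<bar>real_of_int z\<bar> \<le> a} = {-\<lfloor>a\<rfloor>..\<lfloor>a\<rfloor>}"
  by (auto simp: le_floor_iff abs_le_iff) (linarith+)?

lemma finite_abs_real_of_int: "finite {z::int. \<bar>real_of_int z\<bar> \<le> a}"
  by (simp add: abs_real_of_int_le_eq)

lemma card_abs_real_of_int_le:
  fixes a :: real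
  assumes "0 \<le> a"
  shows "real (card {z::int. \<bar>real_of_int z\<bar> \<le> a}) \<le> 2 * a + 1"
proof -
  note abs_real_of_int_le_eq[of a]
  then have "real (card {z::int. \<bar>real_of_int z\<bar> \<le> a}) = of_int (2 * \<lfloor>a\<rfloor> + 1)"
    using assms by simp
  also have "\<dots> \<le> 2 * a + 1" by simp
  finally show ?thesis .
qed

section \<open>Plane geometry in terms of the angle of a direction\<close>

definition dir :: "real \<Rightarrow> real^2" where
  "dir t = vector [cos t, sin t]"

lemma dir_nth [simp]: "dir t $ 1 = cos t" "dir t $ 2 = sin t"
  by (simp_all add: dir_def)

lemma inner_dir: "w \<bullet> dir t = w $ 1 * cos t + w $ 2 * sin t"
  by (simp add: inner_vec_def sum_2)

lemma norm_dir [simp]: "norm (dir t) = 1"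
  by (simp add: norm_eq_1 inner_dir flip: power2_eq_square)

text \<open>Pythagoras in the orthonormal frame turned by \<open>t\<close>; coordinates along and
  across a tube therefore control distance.\<close>

lemma norm_dir_frame: "norm w = sqrt ((w \<bullet> dir t)\<^sup>2 + (w \<bullet> dir (t + pi / 2))\<^sup>2)"
proof -
  have "(w \<bullet> dir t)\<^sup>2 + (w \<bullet> dir (t + pi / 2))\<^sup>2 = ((w$1)\<^sup>2 + (w$2)\<^sup>2) * ((sin t)\<^sup>2 + (cos t)\<^sup>2)"
    unfolding inner_dir sin_add cos_add
    by (simp add: algebra_simps power2_eq_square del: sin_cos_squared_add sin_cos_squared_add2 sin_cos_squared_add3)
  then show ?thesis by (simp add: norm_vec_def L2_set_def sum_2)
qed

text \<open>Expand \<open>dir t\<close> in the frame at angle \<open>s\<close>. When the sine is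
  nonzero, this recovers the transversal coordinate from bounds in the directions \<open>s\<close>
  and \<open>t\<close>.\<close>

lemma inner_dir_rotate:
  "w \<bullet> dir t = cos (t - s) * (w \<bullet> dir s) + sin (t - s) * (w \<bullet> dir (s + pi / 2))"
proof -
  have "dir t = cos (t - s) *\<^sub>R dir s + sin (t - s) *\<^sub>R dir (s + pi / 2)"
    using cos_add[of "t - s" s] sin_add[of "t - s" s]
    by (simp add: vec_eq_iff forall_2 cos_add sin_add)
  then show ?thesis by (simp add: inner_add_right)
qed

text \<open>The two tubes meet in a parallelogram of size about \<open>R\<close> by \<open>R / \<bar>sin (s - t)\<bar>\<close>.\<close>

lemma card_tube_inter_le:
  fixes X Y :: "(real^2) set"
  assumes Y: "finite Y" "Y \<subseteq> X" and R: "R > 0"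
    and tubes: "\<And>y. y \<in> Y \<Longrightarrow> \<bar>(y - p) \<bullet> dir s\<bar> \<le> 2 * R" "\<And>y. y \<in> Y \<Longrightarrow> \<bar>(y - q) \<bullet> dir t\<bar> \<le> 4 * R"
    and "K \<ge> 0" and sin: "sin (s - t) \<noteq> 0"
    and K: "\<And>x. x \<in> X \<Longrightarrow> real (card (Y \<inter> cball x R)) \<le> K"
  shows "real (card Y) \<le> 1000 * K / \<bar>sin (s - t)\<bar>"
proof (cases "Y = {}")
  case False
  then obtain y0 where y0: "y0 \<in> Y" by blast
  define \<rho> where "\<rho> = \<bar>sin (s - t)\<bar>"
  have \<rho>: "0 < \<rho>" "\<rho> \<le> 1" using sin by (auto simp: \<rho>_def)
  \<comment> \<open>Coordinates relative to one point \<open>y0\<close> of \<open>Y\<close>, so that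
    the tube centres \<open>p\<close> and \<open>q\<close> drop out at the cost of doubling the
    widths. The first tube bounds \<open>f\<close>, and the second one then bounds
    \<open>g\<close>.\<close>
  define f where "f y = (y - y0) \<bullet> dir s" for y
  define g where "g y = (y - y0) \<bullet> dir (s + pi / 2)" for y
  have f: "\<bar>f y\<bar> \<le> 4 * R" if "y \<in> Y" for y
    using tubes(1)[OF that] tubes(1)[OF y0] by (simp add: f_def inner_diff_left)
  have g: "\<bar>g y\<bar> \<le> 12 * R / \<rho>" if "y \<in> Y" for y
  proof -
    have "\<bar>(y - y0) \<bullet> dir t\<bar> \<le> 8 * R"
      using tubes(2)[OF that] tubes(2)[OF y0] by (simp add: inner_diff_left)
    moreover have "(y - y0) \<bullet> dir t = cos (t - s) * f y + sin (t - s) * g y"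
      unfolding f_def g_def by (rule inner_dir_rotate)
    moreover have "\<bar>cos (t - s) * f y\<bar> \<le> 1 * (4 * R)"
      unfolding abs_mult using f[OF that] by (intro mult_mono) auto
    ultimately have "\<bar>sin (t - s) * g y\<bar> \<le> 12 * R" by linarith
    moreover have "\<bar>sin (t - s)\<bar> = \<rho>" unfolding \<rho>_def using sin_minus[of "s - t"] by simp
    ultimately have "\<rho> * \<bar>g y\<bar> \<le> 12 * R" by (simp add: abs_mult)
    then show ?thesis using \<rho> by (simp add: field_simps)
  qed
  \<comment> \<open>Index of a grid cell of side \<open>R / 2\<close>. Points in the same cell
    differ by at most \<open>R / 2\<close> in each coordinate, hence lie within distance
    \<open>R\<close>, where the hypothesis on balls applies.\<close>
  define \<phi> where "\<phi> y = (\<lfloor>2 * f y / R\<rfloor>, \<lfloor>2 * g y / R\<rfloor>)" for y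
  define I where "I = {z::int. \<bar>real_of_int z\<bar> \<le> 9} \<times> {z::int. \<bar>real_of_int z\<bar> \<le> 25 / \<rho>}"
  have fl: "\<bar>real_of_int \<lfloor>x\<rfloor>\<bar> \<le> \<bar>x\<bar> + 1" for x :: real by linarith
  have \<phi>: "\<phi> y \<in> I" if "y \<in> Y" for y
  proof -
    have "\<bar>2 * f y / R\<bar> \<le> 8" using f[OF that] R by (simp add: field_simps abs_mult)
    moreover have "\<bar>2 * g y / R\<bar> \<le> 24 / \<rho>" using g[OF that] R \<rho> by (simp add: field_simps abs_mult)
    moreover have "24 / \<rho> + 1 \<le> 25 / \<rho>" using \<rho> by (simp add: field_simps)
    ultimately show ?thesis using fl[of "2 * f y / R"] fl[of "2 * g y / R"]
      by (auto simp: \<phi>_def I_def)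
  qed
  have finI: "finite I" unfolding I_def
    by (intro finite_cartesian_product finite_abs_real_of_int)
  \<comment> \<open>As \<open>\<rho>\<close> is at most 1, the second factor is at most
    \<open>51 / \<rho>\<close>, and 19 times 51 is 969.\<close>
  have cardI: "real (card I) \<le> 1000 / \<rho>"
  proof -
    have "real (card I) \<le> (2 * 9 + 1) * (2 * (25 / \<rho>) + 1)"
      unfolding I_def card_cartesian_product of_nat_mult
      using \<rho> by (intro mult_mono card_abs_real_of_int_le) auto
    also have "\<dots> \<le> 1000 / \<rho>" using \<rho> by (simp add: field_simps)
    finally show ?thesis .
  qed
  have close: "\<bar>a - b\<bar> \<le> R / 2" if "\<bar>2 * a / R - 2 * b / R\<bar> \<le> 1" for a b
  proof -
    have "2 * a / R - 2 * b / R = 2 * (a - b) / R" by (simp add: diff_divide_distrib)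
    then have "\<bar>2 * (a - b)\<bar> \<le> R" using that R by simp
    then show ?thesis unfolding abs_mult by simp
  qed
  have fib: "real (card {y\<in>Y. \<phi> y = c}) \<le> K" for c
  proof (cases "{y\<in>Y. \<phi> y = c} = {}")
    case False
    then obtain y1 where y1: "y1 \<in> Y" "\<phi> y1 = c" by blast
    have "{y\<in>Y. \<phi> y = c} \<subseteq> Y \<inter> cball y1 R"
    proof
      fix y assume "y \<in> {y\<in>Y. \<phi> y = c}"
      then have y: "y \<in> Y" "\<phi> y = \<phi> y1" using y1 by auto
      have "\<bar>2 * f y / R - 2 * f y1 / R\<bar> \<le> 1" "\<bar>2 * g y / R - 2 * g y1 / R\<bar> \<le> 1"
        using y(2) unfolding \<phi>_def prod.inject by linarith+
      then have "\<bar>f y - f y1\<bar> \<le> R / 2" "\<bar>g y - g y1\<bar> \<le> R / 2"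
        using close by auto
      moreover have "f y - f y1 = (y - y1) \<bullet> dir s" "g y - g y1 = (y - y1) \<bullet> dir (s + pi / 2)"
        by (simp_all add: f_def g_def inner_diff_left)
      moreover have "norm (y - y1) \<le> \<bar>(y - y1) \<bullet> dir s\<bar> + \<bar>(y - y1) \<bullet> dir (s + pi / 2)\<bar>"
        unfolding norm_dir_frame[of "y - y1" s] by (rule sqrt_sum_squares_le_sum_abs)
      ultimately have "norm (y - y1) \<le> R" by linarith
      then show "y \<in> Y \<inter> cball y1 R" using y by (simp add: dist_norm norm_minus_commute)
    qed
    then have "card {y\<in>Y. \<phi> y = c} \<le> card (Y \<inter> cball y1 R)" using Y by (intro card_mono) auto
    then show ?thesis using K[of y1] y1 Y by force
  next
    case True
    show ?thesis unfolding True using \<open>K \<ge> 0\<close> by simp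
  qed
  have "card (\<Union>c\<in>I. {y\<in>Y. \<phi> y = c}) \<le> (\<Sum>c\<in>I. card {y\<in>Y. \<phi> y = c})"
    by (rule card_UN_le[OF finI])
  also have "(\<Union>c\<in>I. {y\<in>Y. \<phi> y = c}) = Y" using \<phi> by auto
  finally have "card Y \<le> (\<Sum>c\<in>I. card {y\<in>Y. \<phi> y = c})" .
  then have "real (card Y) \<le> (\<Sum>c\<in>I. real (card {y\<in>Y. \<phi> y = c}))" by (simp flip: of_nat_sum)
  also have "\<dots> \<le> (\<Sum>c\<in>I. K)" by (intro sum_mono fib)
  also have "\<dots> = card I * K" by simp
  also have "\<dots> \<le> 1000 / \<rho> * K" using cardI \<open>K \<ge> 0\<close> by (intro mult_right_mono)
  finally show ?thesis by (simp add: \<rho>_def)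
next
  case True
  then show ?thesis using \<open>K \<ge> 0\<close> by simp
qed

section \<open>Lines as spans of directions\<close>

lemma span_dir_in_G21: "span {dir t} \<in> G21"
  by (simp add: span_in_G21)

text \<open>Only the Lipschitz bound is wanted: it turns intervals of angles into sets of lines of
  small diameter.\<close>

lemma line_angle_span_dir_le: "line_angle (span {dir s}) (span {dir t}) \<le> \<bar>s - t\<bar>"
proof -
  have "dir s \<bullet> dir t = cos (s - t)" by (simp add: inner_dir cos_diff)
  then show ?thesis using arccos_abs_cos_le[of "s - t"] by (simp add: line_angle_span)
qed

text \<open>The choice in \<open>line_coord\<close> leaves a sign open, which is recorded as
  \<open>c\<close>; absolute differences of projections do not see it.\<close>

lemma G21_dir:
  assumes "V \<in> G21"
  obtains t c where "0 \<le> t" "V = span {dir t}" "\<bar>c\<bar> = 1" "line_proj V = (\<lambda>x. c * (x \<bullet> dir t))"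
proof -
  obtain u where u: "norm u = 1" "V = span {u}" using G21_obtain[OF assms] .
  have "(u $ 1)\<^sup>2 + (u $ 2)\<^sup>2 = 1"
    using u(1) by (simp add: norm_vec_def L2_set_def sum_2)
  then obtain t where t: "0 \<le> t" "u $ 1 = cos t" "u $ 2 = sin t" using sincos_total_2pi by metis
  then have d: "u = dir t" by (simp add: vec_eq_iff forall_2)
  have "\<bar>line_coord V u\<bar> = 1"
    using line_coord(2)[OF assms, of u] u by (simp add: span_base)
  moreover have "line_proj V x = line_coord V u * (x \<bullet> dir t)" for x
    using line_coord(1)[OF assms]
    by (simp add: line_proj_def orth_proj_span[OF u(1)] u(2) linear_scale flip: d)
  ultimately show ?thesis using that t u d by blast
qed

text \<open>The derivative of \<open>sin y - y / 2\<close> is nonnegative up to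
  \<open>pi / 3\<close>, which exceeds 1. The range of validity is the reason for treating angles on
  arcs of length 1.\<close>

lemma abs_sin_ge_half:
  assumes "\<bar>x::real\<bar> \<le> 1"
  shows "\<bar>x\<bar> / 2 \<le> \<bar>sin x\<bar>"
proof -
  have *: "y / 2 \<le> sin y" if y: "0 \<le> y" "y \<le> 1" for y :: real
  proof -
    have "sin 0 - 0 / 2 \<le> sin y - y / 2"
    proof (rule DERIV_nonneg_imp_nondecreasing[OF y(1)])
      fix z assume z: "0 \<le> z" "z \<le> y"
      have "cos (pi / 3) \<le> cos z" using z y pi_gt3 by (intro cos_monotone_0_pi_le) auto
      then have "0 \<le> cos z - 1 / 2" by (simp add: cos_60)
      then show "\<exists>d. ((\<lambda>y. sin y - y / 2) has_real_derivative d) (at z) \<and> 0 \<le> d"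
        by (intro exI[of _ "cos z - 1 / 2"] conjI) (auto intro!: derivative_eq_intros)
    qed
    then show ?thesis by simp
  qed
  show ?thesis using *[of x] *[of "- x"] assms by (cases "0 \<le> x") auto
qed

text \<open>One representative is chosen per bin of width \<open>h = K / L\<close>. Representatives
  whose bins are \<open>d \<ge> 2\<close> apart differ by at least \<open>(d - 1) * h\<close>, so
  their tubes share \<open>O(K / ((d - 1) * h)) = O(L / (d - 1))\<close> recorded points. This is
  the harmonic decay that \<open>card_overlap_le\<close> requires, and about \<open>L / K\<close>
  bins account for the logarithm.\<close>

lemma bad_directions_cover:
  fixes X :: "(real^2) set" and a \<delta> R K L :: real
  defines "D \<equiv> {t. a \<le> t \<and> t \<le> a + 1 \<and> (\<exists>x Y. finite Y \<and> Y \<subseteq> X \<and> L \<le> real (card Y) \<and>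
     (\<forall>y\<in>Y. \<bar>(y - x) \<bullet> dir t\<bar> \<le> 2 * R) \<and>
     (\<forall>y\<in>Y. \<forall>y'\<in>Y. y \<noteq> y' \<longrightarrow> 2 * \<delta> < \<bar>(y - y') \<bullet> dir t\<bar>))}"
  assumes X: "bounded X" and \<delta>: "0 < \<delta>" "\<delta> \<le> R" and K: "0 < K" and L: "0 < L"
    and KX: "\<And>x. x \<in> X \<Longrightarrow> real (covering_number \<delta> (X \<inter> cball x R)) \<le> K"
  shows "\<exists>J::nat set. finite J \<and> D \<subseteq> (\<Union>k\<in>J. {a + real k * (K / L)..a + (real k + 1) * (K / L)}) \<and>
     real (card J) * L \<le> 12000 * (2 + ln (1 + L / K)) * covering_number \<delta> X"
proof -
  define h where "h = K / L"
  have h: "0 < h" using K L by (simp add: h_def)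
  define bin where "bin t = nat \<lfloor>(t - a) / h\<rfloor>" for t
  \<comment> \<open>The largest possible bin number, since an arc of length 1 has
    \<open>1 / h = L / K\<close>; the endpoint \<open>a + 1\<close> is included.\<close>
  define m where "m = nat \<lfloor>L / K\<rfloor>"
  \<comment> \<open>The overlap count needs sets of one common size, so each witness set is trimmed
    to exactly \<open>N\<close> points.\<close>
  define N where "N = nat \<lceil>L\<rceil>"
  have N: "N > 0" "L \<le> real N" using L by (auto simp: N_def)
  have m: "real m \<le> L / K" using K L by (simp add: m_def)
  define J where "J = bin ` D"
  have in_bin: "a + real (bin t) * h \<le> t" "t < a + (real (bin t) + 1) * h" if "t \<in> D" for t
  proof -
    have "0 \<le> (t - a) / h" using that h by (simp add: D_def)
    then have "real (bin t) \<le> (t - a) / h" "(t - a) / h < real (bin t) + 1"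
      unfolding bin_def by auto
    then show "a + real (bin t) * h \<le> t" "t < a + (real (bin t) + 1) * h"
      using h by (simp_all add: field_simps)
  qed
  have J: "J \<subseteq> {..m}"
  proof
    fix k assume "k \<in> J"
    then obtain t where t: "t \<in> D" "k = bin t" by (auto simp: J_def)
    have "(t - a) / h \<le> 1 / h" using t h by (intro divide_right_mono) (auto simp: D_def)
    also have "1 / h = L / K" by (simp add: h_def)
    finally show "k \<in> {..m}" by (auto simp: t bin_def m_def intro!: nat_mono floor_mono)
  qed
  then have finJ: "finite J" using finite_subset by blast
  have "\<forall>k\<in>J. \<exists>t. t \<in> D \<and> bin t = k" by (auto simp: J_def)
  then obtain \<tau> where \<tau>: "\<And>k. k \<in> J \<Longrightarrow> \<tau> k \<in> D" "\<And>k. k \<in> J \<Longrightarrow> bin (\<tau> k) = k"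
    using bchoice[of J "\<lambda>k t. t \<in> D \<and> bin t = k"] by auto
  have "\<exists>Y. finite Y \<and> Y \<subseteq> X \<and> card Y = N \<and> (\<exists>x. \<forall>y\<in>Y. \<bar>(y - x) \<bullet> dir (\<tau> k)\<bar> \<le> 2 * R) \<and>
     (\<forall>y\<in>Y. \<forall>y'\<in>Y. y \<noteq> y' \<longrightarrow> 2 * \<delta> < \<bar>(y - y') \<bullet> dir (\<tau> k)\<bar>)" if k: "k \<in> J" for k
  proof -
    obtain x Y where Y: "finite Y" "Y \<subseteq> X" "L \<le> real (card Y)" "\<forall>y\<in>Y. \<bar>(y - x) \<bullet> dir (\<tau> k)\<bar> \<le> 2 * R"
      "\<forall>y\<in>Y. \<forall>y'\<in>Y. y \<noteq> y' \<longrightarrow> 2 * \<delta> < \<bar>(y - y') \<bullet> dir (\<tau> k)\<bar>"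
      using \<tau>(1)[OF k] unfolding D_def by blast
    have "N \<le> card Y" using Y(3) by (simp add: N_def ceiling_le_iff)
    then obtain Y' where Y': "Y' \<subseteq> Y" "card Y' = N" "finite Y'" by (rule obtain_subset_with_card_n)
    note s = Y(5)[rule_format, OF subsetD[OF Y'(1)] subsetD[OF Y'(1)]]
    show ?thesis using Y(1,2,4) Y' s by (intro exI[of _ Y'] conjI exI[of _ x]) auto
  qed
  from bchoice[OF ballI[OF this]] obtain Y where "\<forall>k\<in>J. finite (Y k) \<and> Y k \<subseteq> X \<and> card (Y k) = N \<and>
     (\<exists>x. \<forall>y\<in>Y k. \<bar>(y - x) \<bullet> dir (\<tau> k)\<bar> \<le> 2 * R) \<and>
     (\<forall>y\<in>Y k. \<forall>y'\<in>Y k. y \<noteq> y' \<longrightarrow> 2 * \<delta> < \<bar>(y - y') \<bullet> dir (\<tau> k)\<bar>)" by (rule exE)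
  then have Y: "finite (Y k)" "Y k \<subseteq> X" "card (Y k) = N"
    "\<exists>x. \<forall>y\<in>Y k. \<bar>(y - x) \<bullet> dir (\<tau> k)\<bar> \<le> 2 * R"
    and sep_all: "\<forall>y\<in>Y k. \<forall>y'\<in>Y k. y \<noteq> y' \<longrightarrow> 2 * \<delta> < \<bar>(y - y') \<bullet> dir (\<tau> k)\<bar>"
    if "k \<in> J" for k using that by simp_all
  have sep: "y \<in> Y k \<Longrightarrow> y' \<in> Y k \<Longrightarrow> y \<noteq> y' \<Longrightarrow> 2 * \<delta> < \<bar>(y - y') \<bullet> dir (\<tau> k)\<bar>"
    if "k \<in> J" for k y y' using sep_all[OF that] by simp
  have inner_le: "\<bar>v \<bullet> dir t\<bar> \<le> norm v" for v t
    using Cauchy_Schwarz_ineq2[of v "dir t"] by simp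
  have sep': "2 * \<delta> < dist y y'" if "k \<in> J" "y \<in> Y k" "y' \<in> Y k" "y \<noteq> y'" for k y y'
    using sep[OF that] inner_le[of "y - y'" "\<tau> k"] by (simp add: dist_norm)
  obtain S where S: "finite S" "card S = covering_number \<delta> X" "X \<subseteq> (\<Union>c\<in>S. cball c \<delta>)"
    using covering_number_exists[OF X \<delta>(1)] .
  \<comment> \<open>\<open>\<sigma>\<close> records a point by a nearby centre of one optimal cover,
    which places the sets for all bins inside the same finite \<open>S\<close>. Two points with the
    same record are at most \<open>2 * \<delta>\<close> apart, so \<open>\<sigma>\<close> is
    injective on each separated set.\<close>
  have "\<forall>y\<in>X. \<exists>c. c \<in> S \<and> dist c y \<le> \<delta>" using S(3) by fastforce
  from bchoice[OF this] obtain \<sigma> where \<sigma>: "\<And>y. y \<in> X \<Longrightarrow> \<sigma> y \<in> S \<and> dist (\<sigma> y) y \<le> \<delta>" by blast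
  have \<sigma>_close: "dist y y' \<le> 2 * \<delta>" if "y \<in> X" "y' \<in> X" "\<sigma> y = \<sigma> y'" for y y'
    using \<sigma>[OF that(1)] \<sigma>[OF that(2)] that(3) dist_triangle2[of y y' "\<sigma> y"]
    by (simp add: dist_commute)
  define E where "E k = \<sigma> ` Y k" for k
  have inj: "inj_on \<sigma> (Y k)" if "k \<in> J" for k
  proof (rule inj_onI, rule ccontr)
    fix y y' assume *: "y \<in> Y k" "y' \<in> Y k" "\<sigma> y = \<sigma> y'" "y \<noteq> y'"
    then show False using sep'[OF that *(1,2,4)] \<sigma>_close[of y y'] Y(2)[OF that] by force
  qed
  have KY: "real (card (Y k \<inter> cball x R)) \<le> K" if "k \<in> J" "x \<in> X" for k x
  proof -
    have "card (Y k \<inter> cball x R) \<le> covering_number \<delta> (X \<inter> cball x R)"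
      using Y[OF that(1)] sep'[OF that(1)] \<delta>
      by (intro separated_card_le) (auto intro: bounded_Int)
    then show ?thesis using KX[OF that(2)] by linarith
  qed
  have "real (card J) * N \<le> 2 * 6000 * (2 + ln (1 + real m)) * card S"
  proof (rule card_overlap_le[OF S(1) J N(1)])
    fix k assume k: "k \<in> J"
    show "E k \<subseteq> S" using Y(2)[OF k] \<sigma> by (auto simp: E_def)
    show "card (E k) = N" using Y(3)[OF k] inj[OF k] by (simp add: E_def card_image)
  next
    fix k l assume kl: "k \<in> J" "l \<in> J"
    define d where "d = \<bar>real k - real l\<bar>"
    show "real (card (E k \<inter> E l)) \<le> 6000 * real N / (1 + \<bar>real k - real l\<bar>)"
      unfolding d_def[symmetric]
    proof (cases "d \<le> 1")
      case True
      \<comment> \<open>In equal or adjacent bins the angle between representatives has no useful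
        lower bound, so the trivial bound \<open>N\<close> is taken.\<close>
      have "card (E k \<inter> E l) \<le> card (E k)" using Y(1)[OF kl(1)] by (intro card_mono) (auto simp: E_def)
      also have "card (E k) = N" using Y(3)[OF kl(1)] inj[OF kl(1)] by (simp add: E_def card_image)
      finally have "real (card (E k \<inter> E l)) \<le> real N" by simp
      also have "\<dots> \<le> 6000 * real N / (1 + d)"
      proof -
        have "real N * (1 + d) \<le> real N * 6000" using True by (intro mult_left_mono) auto
        then show ?thesis by (simp add: d_def field_simps)
      qed
      finally show "real (card (E k \<inter> E l)) \<le> 6000 * real N / (1 + d)" .
    next
      case False
      \<comment> \<open>Bin numbers are integers, so the gap jumps from 1 to 2; this later gives
        \<open>1 + d \<le> 3 * (d - 1)\<close>.\<close>
      have d2: "d \<ge> 2"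
      proof -
        have "d = real_of_int \<bar>int k - int l\<bar>" by (simp add: d_def)
        moreover from this False have "\<bar>int k - int l\<bar> > 1" by linarith
        then have "\<bar>int k - int l\<bar> \<ge> 2" by simp
        ultimately show ?thesis by linarith
      qed
      define \<rho> where "\<rho> = \<tau> k - \<tau> l"
      have tau: "\<tau> k \<in> D" "\<tau> l \<in> D" using \<tau>(1) kl by auto
      have \<rho>1: "\<bar>\<rho>\<bar> \<le> 1" using tau by (auto simp: \<rho>_def D_def)
      have \<rho>d: "(d - 1) * h \<le> \<bar>\<rho>\<bar>"
      proof (cases "l \<le> k")
        case True
        have "(d - 1) * h = real k * h - (real l + 1) * h" using True by (simp add: d_def algebra_simps)
        then show ?thesis using in_bin[OF tau(1)] in_bin[OF tau(2)] \<tau>(2)[OF kl(1)] \<tau>(2)[OF kl(2)]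
          by (simp add: \<rho>_def)
      next
        case False
        then have "(d - 1) * h = real l * h - (real k + 1) * h" by (simp add: d_def algebra_simps)
        then show ?thesis using in_bin[OF tau(1)] in_bin[OF tau(2)] \<tau>(2)[OF kl(1)] \<tau>(2)[OF kl(2)]
          by (simp add: \<rho>_def)
      qed
      have "0 < (d - 1) * h" using d2 h by simp
      then have \<rho>0: "\<bar>\<rho>\<bar> > 0" using \<rho>d by linarith
      have sin: "\<bar>\<rho>\<bar> / 2 \<le> \<bar>sin \<rho>\<bar>" by (rule abs_sin_ge_half[OF \<rho>1])
      obtain p where p: "\<forall>y\<in>Y k. \<bar>(y - p) \<bullet> dir (\<tau> k)\<bar> \<le> 2 * R" using Y(4)[OF kl(1)] by blast
      obtain q where q: "\<forall>y\<in>Y l. \<bar>(y - q) \<bullet> dir (\<tau> l)\<bar> \<le> 2 * R" using Y(4)[OF kl(2)] by blast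
      \<comment> \<open>Points with equal records may differ by
        \<open>2 * \<delta> \<le> 2 * R\<close>, so a point of \<open>Y k\<close> sharing its record
        with a point of \<open>Y l\<close> lies in the tube of \<open>l\<close> widened to
        \<open>4 * R\<close>.\<close>
      define W where "W = {y\<in>Y k. \<bar>(y - q) \<bullet> dir (\<tau> l)\<bar> \<le> 4 * R}"
      have W: "W \<subseteq> Y k" "finite W" using Y(1)[OF kl(1)] by (auto simp: W_def)
      have "E k \<inter> E l \<subseteq> \<sigma> ` W"
      proof
        fix z assume "z \<in> E k \<inter> E l"
        then obtain y y' where y: "y \<in> Y k" "y' \<in> Y l" "z = \<sigma> y" "\<sigma> y = \<sigma> y'" by (auto simp: E_def)
        have "dist y y' \<le> 2 * \<delta>" using y Y(2)[OF kl(1)] Y(2)[OF kl(2)] by (intro \<sigma>_close) auto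
        then have "\<bar>(y - y') \<bullet> dir (\<tau> l)\<bar> \<le> 2 * R"
          using inner_le[of "y - y'" "\<tau> l"] \<delta> by (simp add: dist_norm)
        moreover have "\<bar>(y' - q) \<bullet> dir (\<tau> l)\<bar> \<le> 2 * R" using q y by blast
        moreover have "(y - q) \<bullet> dir (\<tau> l) = (y - y') \<bullet> dir (\<tau> l) + (y' - q) \<bullet> dir (\<tau> l)"
          by (simp add: inner_diff_left)
        ultimately have "\<bar>(y - q) \<bullet> dir (\<tau> l)\<bar> \<le> 4 * R" by linarith
        then have "y \<in> W" using y(1) by (simp add: W_def)
        then show "z \<in> \<sigma> ` W" unfolding y(3) by (rule imageI)
      qed
      then have "card (E k \<inter> E l) \<le> card W" using W(2) by (meson card_image_le card_mono finite_imageI order_trans)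
      then have "real (card (E k \<inter> E l)) \<le> real (card W)" by simp
      also have "\<dots> \<le> 1000 * K / \<bar>sin (\<tau> k - \<tau> l)\<bar>"
      proof (rule card_tube_inter_le[where X = X and R = R and p = p and q = q])
        fix x assume "x \<in> X"
        have "card (W \<inter> cball x R) \<le> card (Y k \<inter> cball x R)"
          using W Y(1)[OF kl(1)] by (intro card_mono) auto
        then show "real (card (W \<inter> cball x R)) \<le> K" using KY[OF kl(1) \<open>x \<in> X\<close>] by linarith
      next
        show "sin (\<tau> k - \<tau> l) \<noteq> 0" using sin \<rho>0 by (auto simp: \<rho>_def)
      qed (use W Y(2)[OF kl(1)] \<delta> K p in \<open>auto simp: W_def\<close>)
      \<comment> \<open>The sine is at least half the angle, and the angle is at least
        \<open>(d - 1) * h\<close>. Substituting \<open>h = K / L\<close> then removes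
        \<open>K\<close>.\<close>
      also have "\<dots> \<le> 1000 * K / ((d - 1) * h / 2)"
        using sin \<rho>d \<rho>0 K d2 h by (intro divide_left_mono mult_pos_pos) (auto simp: \<rho>_def)
      also have "\<dots> = 2000 * L / (d - 1)" using K L d2 by (simp add: h_def field_simps)
      also have "\<dots> \<le> 2000 * real N / (d - 1)" using N(2) d2 by (intro divide_right_mono) auto
      also have "\<dots> \<le> 6000 * real N / (1 + d)"
      proof -
        have "real N * (1 + d) \<le> real N * (3 * (d - 1))" using d2 by (intro mult_left_mono) auto
        then show ?thesis using d2 by (simp add: field_simps)
      qed
      finally show "real (card (E k \<inter> E l)) \<le> 6000 * real N / (1 + d)" .
    qed
  qed simp
  then have *: "real (card J) * N \<le> 12000 * (2 + ln (1 + real m)) * card S" by simp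
  have "real (card J) * L \<le> real (card J) * N" using N by (intro mult_left_mono) auto
  also note *
  also have "12000 * (2 + ln (1 + real m)) * card S \<le> 12000 * (2 + ln (1 + L / K)) * card S"
    using m by (intro mult_right_mono mult_left_mono add_left_mono) auto
  finally have "real (card J) * L \<le> 12000 * (2 + ln (1 + L / K)) * covering_number \<delta> X"
    by (simp add: S)
  moreover have "D \<subseteq> (\<Union>k\<in>J. {a + real k * (K / L)..a + (real k + 1) * (K / L)})"
  proof
    fix t assume "t \<in> D"
    then show "t \<in> (\<Union>k\<in>J. {a + real k * (K / L)..a + (real k + 1) * (K / L)})"
      using in_bin[of t] unfolding J_def h_def[symmetric] by (intro UN_I[of "bin t"]) auto
  qed
  ultimately show ?thesis using finJ by blast
qed

section \<open>Exceptional lines\<close>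

text \<open>Apart from the logarithm the content is of order
  \<open>x powr ((1 + \<alpha>) * p - b - \<alpha> * q)\<close>, that is
  \<open>x powr (2 * e)\<close>. The logarithm is at most a constant times
  \<open>x powr (- e)\<close>, so half of the surplus exponent survives.\<close>

lemma content_bound:
  fixes p q b \<alpha> c1 c2 c3 :: real
  assumes "0 \<le> p" "0 \<le> q" "0 \<le> \<alpha>" "b + \<alpha> * q < (1 + \<alpha>) * p" "0 < c1" "0 < c2" "0 < c3"
  obtains c e where "0 < c" "0 < e"
    "\<And>x L K P. 0 < x \<Longrightarrow> x < 1 \<Longrightarrow> L = c1 * x powr (- p) \<Longrightarrow> K = c2 * x powr (- q) \<Longrightarrow> 0 \<le> P \<Longrightarrow>
       P \<le> c3 * x powr (- b) \<Longrightarrow> 12000 * (2 + ln (1 + L / K)) * P / L * (K / L) powr \<alpha> \<le> c * x powr e"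
proof -
  define e where "e = ((1 + \<alpha>) * p - (b + \<alpha> * q)) / 2"
  have e: "0 < e" using assms by (simp add: e_def)
  define D where "D = 1 + c1 / c2"
  have D: "D \<ge> 1" using assms by (simp add: D_def)
  define c' where "c' = 2 + ln D + p / e"
  have c': "c' > 0" using D e assms(1) by (simp add: c'_def add_pos_nonneg)
  define c where "c = 12000 * c' * (c3 / c1) * (c2 / c1) powr \<alpha>"
  show ?thesis
  proof (rule that[OF _ e])
    show "0 < c" using c' assms by (simp add: c_def)
    fix x L K P :: real
    assume x: "0 < x" "x < 1" and L: "L = c1 * x powr (- p)" and K: "K = c2 * x powr (- q)"
      and P: "0 \<le> P" "P \<le> c3 * x powr (- b)"
    have LK: "L > 0" "K > 0" using L K x assms by auto
    have xe: "x powr (- e) \<ge> 1" using x e by (simp add: powr_minus one_le_inverse_iff powr_le1)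
    have lnx: "- ln x \<le> x powr (- e) / e"
      using ln_powr_bound[of "1 / x" e] x e by (simp add: ln_div powr_divide powr_minus_divide)
    have "L / K = c1 / c2 * (x powr (- p) / x powr (- q))" by (simp add: L K)
    also have "\<dots> \<le> c1 / c2 * x powr (- p)"
    proof (rule mult_left_mono)
      have "x powr (- q) \<ge> 1" using x assms(2) by (simp add: powr_minus one_le_inverse_iff powr_le1)
      then show "x powr (- p) / x powr (- q) \<le> x powr (- p)"
        by (simp add: divide_le_eq mult_le_cancel_left1)
    qed (use assms in auto)
    finally have "1 + L / K \<le> x powr (- p) + c1 / c2 * x powr (- p)"
      using x assms(1) by (simp add: powr_minus one_le_inverse_iff powr_le1 add_mono)
    also have "\<dots> = D * x powr (- p)" by (simp add: D_def algebra_simps)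
    finally have le: "1 + L / K \<le> D * x powr (- p)" .
    have pos: "0 < 1 + L / K" using LK by (simp add: add_pos_pos)
    have "ln (1 + L / K) \<le> ln (D * x powr (- p))" using le pos by (subst ln_le_cancel_iff) auto
    also have "\<dots> = ln D + p * (- ln x)" using D x by (simp add: ln_mult ln_powr)
    also have "\<dots> \<le> ln D + p * (x powr (- e) / e)" using lnx assms(1) by (intro add_left_mono mult_left_mono)
    finally have "2 + ln (1 + L / K) \<le> (2 + ln D) * 1 + p / e * x powr (- e)" by simp
    also have "\<dots> \<le> (2 + ln D) * x powr (- e) + p / e * x powr (- e)"
      using xe D by (intro add_right_mono mult_left_mono) auto
    also have "\<dots> = c' * x powr (- e)" by (simp add: c'_def algebra_simps)
    finally have ln_le: "2 + ln (1 + L / K) \<le> c' * x powr (- e)" .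
    have ln0: "0 \<le> ln (1 + L / K)" using LK by (intro ln_ge_zero) auto
    have "(K / L) powr \<alpha> = (c2 / c1 * x powr (p - q)) powr \<alpha>"
      by (simp add: K L powr_diff powr_minus field_simps)
    also have "\<dots> = (c2 / c1) powr \<alpha> * x powr ((p - q) * \<alpha>)"
      using assms x by (subst powr_mult) (auto simp: powr_powr)
    finally have KL: "(K / L) powr \<alpha> = (c2 / c1) powr \<alpha> * x powr ((p - q) * \<alpha>)" .
    have "12000 * (2 + ln (1 + L / K)) * P / L * (K / L) powr \<alpha>
        \<le> 12000 * (c' * x powr (- e)) * (c3 * x powr (- b)) / L * (K / L) powr \<alpha>"
      using ln_le ln0 P LK c' by (intro mult_right_mono divide_right_mono mult_mono mult_left_mono) auto
    also have "\<dots> = c * (x powr (- e) * x powr (- b) / x powr (- p) * x powr ((p - q) * \<alpha>))"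
      unfolding KL by (simp add: c_def L)
    also have "x powr (- e) * x powr (- b) / x powr (- p) * x powr ((p - q) * \<alpha>)
        = x powr ((- e) + (- b) - (- p) + (p - q) * \<alpha>)"
      by (simp only: powr_add powr_diff)
    also have "(- e) + (- b) - (- p) + (p - q) * \<alpha> = e" by (simp add: e_def field_simps)
    finally show "12000 * (2 + ln (1 + L / K)) * P / L * (K / L) powr \<alpha> \<le> c * x powr e" .
  qed
qed

text \<open>
  All radii in \<open>(r, 2 r]\<close> are treated at once, so that covering numbers of the projection at
  different radii need not be compared when passing to dyadic \<open>r\<close>.
\<close>

definition bad_lines :: "(real^2) set \<Rightarrow> real \<Rightarrow> real \<Rightarrow> real \<Rightarrow> (real^2) set set" where
  "bad_lines X \<theta> s r = {V \<in> G21. \<exists>R x. r < R \<and> R \<le> 2 * r \<and> x \<in> line_proj V ` X \<and>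
     (R / R powr (1 / \<theta>)) powr s < covering_number (R powr (1 / \<theta>)) (line_proj V ` X \<inter> cball x R)}"

section \<open>From the Assouad spectrum of a projection to bad dyadic scales\<close>

lemma bounded_line_proj:
  assumes "bounded X" "V \<in> G21"
  shows "bounded (line_proj V ` X)"
proof -
  obtain t c where "line_proj V = (\<lambda>x. c * (x \<bullet> dir t))" using G21_dir[OF assms(2)] .
  then have "bounded_linear (line_proj V)"
    by (simp add: bounded_linear_const_mult bounded_linear_inner_left)
  then show ?thesis using assms(1) by (rule bounded_linear_image[rotated])
qed

text \<open>If only finitely many scales were bad, the covering bound with exponent \<open>s\<close>
  would hold with constant 1 for small \<open>R\<close>, and one fixed covering number would serve
  all larger \<open>R\<close>; then the spectrum would be at most \<open>s\<close>.\<close>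

lemma infinitely_often_bad:
  assumes X: "bounded X" and \<theta>: "0 < \<theta>" "\<theta> < 1" and s: "0 \<le> s" and V: "V \<in> G21"
    and spec: "ereal s < assouad_spectrum \<theta> (line_proj V ` X)"
  shows "\<exists>\<^sub>\<infinity>n. V \<in> bad_lines X \<theta> s ((1 / 2) ^ Suc n)"
proof (rule ccontr)
  assume "\<not> ?thesis"
  then obtain n0 where n0: "\<And>n. n \<ge> n0 \<Longrightarrow> V \<notin> bad_lines X \<theta> s ((1 / 2) ^ Suc n)"
    by (auto simp: INFM_nat_le)
  let ?P = "line_proj V ` X"
  \<comment> \<open>A lower bound for the covering radii that belong to all \<open>R\<close> above
    \<open>(1 / 2) ^ n0\<close>.\<close>
  define r where "r = ((1 / 2) ^ n0) powr (1 / \<theta>)"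
  have r: "0 < r" by (simp add: r_def)
  have bP: "bounded ?P" by (rule bounded_line_proj[OF X V])
  define C where "C = max 1 (real (covering_number r ?P))"
  have "assouad_spectrum \<theta> ?P \<le> ereal s"
  proof (rule assouad_spectrum_le[OF s])
    show "C > 0" by (simp add: C_def)
    fix R :: real and x assume R: "0 < R" "R < 1" "x \<in> ?P"
    have ge1: "(R / R powr (1 / \<theta>)) powr s \<ge> 1"
      using scale_ratio_ge_1[OF \<theta> R(1,2)] s by (rule ge_one_powr_ge_zero)
    show "real (covering_number (R powr (1 / \<theta>)) (?P \<inter> cball x R)) \<le> C * (R / R powr (1 / \<theta>)) powr s"
    proof (cases "R \<le> (1 / 2) ^ n0")
      case True
      obtain k where k: "(1 / 2) ^ k < R" using real_arch_pow_inv[of R "1 / 2"] R by auto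
      \<comment> \<open>The first power of 1/2 below \<open>R\<close> locates \<open>R\<close> in a
        dyadic range. It is not the zeroth power because \<open>R < 1\<close>, so a predecessor
        \<open>n\<close> exists and \<open>R\<close> is at most twice
        \<open>(1 / 2) ^ Suc n\<close>.\<close>
      define m where "m = (LEAST k. (1 / 2) ^ k < R)"
      have m: "(1 / 2) ^ m < R" unfolding m_def by (rule LeastI[of _ k]) (rule k)
      have "m \<noteq> 0" using m R by (intro notI) simp
      then obtain n where n: "m = Suc n" by (cases m) auto
      have "\<not> (1 / 2) ^ n < R" using not_less_Least[of n "\<lambda>k. (1 / 2) ^ k < R"] n by (simp add: m_def)
      then have n2: "R \<le> 2 * (1 / 2) ^ Suc n" by simp
      have "(1 / 2 :: real) ^ Suc n < (1 / 2) ^ n0" using m True n by simp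
      then have "n0 < Suc n" by (simp add: power_strict_decreasing_iff del: power_Suc)
      then have "V \<notin> bad_lines X \<theta> s ((1 / 2) ^ Suc n)" by (intro n0) simp
      then have "\<not> (R / R powr (1 / \<theta>)) powr s < covering_number (R powr (1 / \<theta>)) (?P \<inter> cball x R)"
        using V R m n n2 unfolding bad_lines_def by blast
      also have "1 * (R / R powr (1 / \<theta>)) powr s \<le> C * (R / R powr (1 / \<theta>)) powr s"
        by (intro mult_right_mono) (auto simp: C_def)
      ultimately show ?thesis by simp
    next
      case False
      have "r \<le> R powr (1 / \<theta>)" unfolding r_def using False \<theta> by (intro powr_mono2) auto
      then have "real (covering_number (R powr (1 / \<theta>)) (?P \<inter> cball x R)) \<le> real (covering_number r ?P)"
        using covering_number_mono[OF bP, of "?P \<inter> cball x R" r "R powr (1 / \<theta>)"] r by simp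
      also have "\<dots> \<le> C * 1" by (simp add: C_def)
      also have "\<dots> \<le> C * (R / R powr (1 / \<theta>)) powr s" using ge1 by (intro mult_left_mono) (auto simp: C_def)
      finally show ?thesis .
    qed
  qed
  with spec show False by simp
qed

text \<open>Lifts separated points of the projection to \<open>X\<close> and applies
  \<open>bad_directions_cover\<close>. The threshold
  \<open>(R / R powr (1 / \<theta>)) powr s\<close> decreases in \<open>R\<close>, so over the radii
  up to \<open>2 * r\<close> it is smallest at \<open>2 * r\<close>; \<open>L\<close> is half that
  value because \<open>max_separated_real\<close> loses a factor 2.\<close>

lemma bad_lines_cover:
  fixes X :: "(real^2) set"
  assumes X: "bounded X" and \<theta>: "0 < \<theta>" "\<theta> < 1" and s: "0 \<le> s" and r: "0 < r" "r < 1"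
    and K: "0 < K" and L: "L = (2 * r) powr (- ((1 / \<theta> - 1) * s)) / 2"
    and KX: "\<And>x. x \<in> X \<Longrightarrow> real (covering_number (r powr (1 / \<theta>)) (X \<inter> cball x r)) \<le> K"
  shows "\<exists>\<U>. finite \<U> \<and> {V \<in> bad_lines X \<theta> s r. \<exists>t c. a \<le> t \<and> t \<le> a + 1 \<and> V = span {dir t} \<and> \<bar>c\<bar> = 1
        \<and> line_proj V = (\<lambda>x. c * (x \<bullet> dir t))} \<subseteq> \<Union>\<U> \<and>
      (\<forall>U\<in>\<U>. U \<subseteq> G21 \<and> G21.ediam U \<le> ennreal (K / L)) \<and>
      real (card \<U>) * L \<le> 12000 * (2 + ln (1 + L / K)) * covering_number (r powr (1 / \<theta>)) X"
proof -
  define \<delta> where "\<delta> = r powr (1 / \<theta>)"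
  have "r powr (1 / \<theta>) \<le> r powr 1"
    using \<theta> r by (intro powr_mono') (auto simp: field_simps simp del: powr_one)
  then have \<delta>: "0 < \<delta>" "\<delta> \<le> r" using r by (auto simp: \<delta>_def)
  have L0: "0 < L" using r by (simp add: L)
  let ?D = "{t. a \<le> t \<and> t \<le> a + 1 \<and> (\<exists>x Y. finite Y \<and> Y \<subseteq> X \<and> L \<le> real (card Y) \<and>
     (\<forall>y\<in>Y. \<bar>(y - x) \<bullet> dir t\<bar> \<le> 2 * r) \<and>
     (\<forall>y\<in>Y. \<forall>y'\<in>Y. y \<noteq> y' \<longrightarrow> 2 * \<delta> < \<bar>(y - y') \<bullet> dir t\<bar>))}"
  obtain J :: "nat set" where J: "finite J" "?D \<subseteq> (\<Union>k\<in>J. {a + real k * (K / L)..a + (real k + 1) * (K / L)})"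
     "real (card J) * L \<le> 12000 * (2 + ln (1 + L / K)) * covering_number \<delta> X"
    using bad_directions_cover[OF X \<delta> K L0 KX[folded \<delta>_def], of a] by blast
  define U where "U k = (\<lambda>t. span {dir t}) ` {a + real k * (K / L)..a + (real k + 1) * (K / L)}" for k
  have ediam: "G21.ediam (U k) \<le> ennreal (K / L)" for k
    unfolding G21.ediam_def
  proof (intro SUP_least ennreal_leI)
    fix V W assume "V \<in> U k" "W \<in> U k"
    then obtain t t' where t: "t \<in> {a + real k * (K / L)..a + (real k + 1) * (K / L)}" "V = span {dir t}"
      "t' \<in> {a + real k * (K / L)..a + (real k + 1) * (K / L)}" "W = span {dir t'}"
      unfolding U_def by blast
    have "line_angle V W \<le> \<bar>t - t'\<bar>" unfolding t by (rule line_angle_span_dir_le)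
    also have "\<dots> \<le> K / L" using t(1,3) unfolding atLeastAtMost_iff distrib_right abs_le_iff by linarith
    finally show "line_angle V W \<le> K / L" .
  qed
  have sub: "V \<in> \<Union>(U ` J)" if V: "V \<in> bad_lines X \<theta> s r" "a \<le> t" "t \<le> a + 1" "V = span {dir t}"
    and c: "\<bar>c\<bar> = 1" "line_proj V = (\<lambda>x. c * (x \<bullet> dir t))" for V t c
  proof -
    obtain R x where R: "r < R" "R \<le> 2 * r" "x \<in> line_proj V ` X" and
      big: "(R / R powr (1 / \<theta>)) powr s < covering_number (R powr (1 / \<theta>)) (line_proj V ` X \<inter> cball x R)"
      and G: "V \<in> G21"
      using V(1) unfolding bad_lines_def by blast
    have R0: "0 < R" using R r by linarith
    let ?A = "line_proj V ` X \<inter> cball x R"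
    have "bounded ?A" using bounded_line_proj[OF X G] by (simp add: bounded_Int)
    moreover have "0 < R powr (1 / \<theta>)" using R0 by simp
    ultimately obtain Z where Z: "finite Z" "Z \<subseteq> ?A"
      "\<And>z z'. z \<in> Z \<Longrightarrow> z' \<in> Z \<Longrightarrow> z \<noteq> z' \<Longrightarrow> dist z z' > 2 * R powr (1 / \<theta>)"
      "covering_number (R powr (1 / \<theta>)) ?A \<le> 2 * card Z"
      using max_separated_real by blast
    have \<delta>R: "\<delta> \<le> R powr (1 / \<theta>)" unfolding \<delta>_def using R r \<theta> by (intro powr_mono2) auto
    have proj: "\<bar>line_proj V y - line_proj V y'\<bar> = \<bar>(y - y') \<bullet> dir t\<bar>" for y y'
    proof -
      have "line_proj V y - line_proj V y' = c * ((y - y') \<bullet> dir t)"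
        unfolding c(2) by (simp add: inner_diff_left right_diff_distrib)
      then show ?thesis using c(1) by (simp add: abs_mult)
    qed
    have "\<forall>z\<in>Z. \<exists>y. y \<in> X \<and> line_proj V y = z" using Z(2) by auto
    from bchoice[OF this] obtain f where f: "\<And>z. z \<in> Z \<Longrightarrow> f z \<in> X \<and> line_proj V (f z) = z" by blast
    have inj: "inj_on f Z" by (rule inj_onI) (metis f)
    obtain x1 where x1: "x1 \<in> X" "x = line_proj V x1" using R(3) by blast
    have "t \<in> ?D"
    proof (intro CollectI conjI exI[of _ x1] exI[of _ "f ` Z"] ballI impI)
      show "finite (f ` Z)" "f ` Z \<subseteq> X" using Z(1) f by auto
      have "(2 * r) powr (- ((1 / \<theta> - 1) * s)) \<le> R powr (- ((1 / \<theta> - 1) * s))"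
        using R R0 \<theta> s by (intro powr_mono2') auto
      also have "\<dots> = (R powr (1 - 1 / \<theta>)) powr s" by (simp add: powr_powr algebra_simps)
      also have "\<dots> = (R / R powr (1 / \<theta>)) powr s" using R0 by (simp add: powr_diff)
      finally have "2 * L \<le> (R / R powr (1 / \<theta>)) powr s" by (simp add: L)
      also have "\<dots> \<le> real (2 * card Z)" using big Z(4) by linarith
      finally show "L \<le> real (card (f ` Z))" by (simp add: card_image[OF inj])
    next
      fix y assume "y \<in> f ` Z"
      then obtain z where z: "z \<in> Z" "y = f z" by blast
      have "\<bar>(y - x1) \<bullet> dir t\<bar> = \<bar>z - x\<bar>" using f[OF z(1)] x1 z proj[of y x1] by simp
      also have "\<dots> \<le> R" using Z(2) z(1) by (auto simp: dist_real_def abs_minus_commute)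
      finally show "\<bar>(y - x1) \<bullet> dir t\<bar> \<le> 2 * r" using R by linarith
    next
      fix y y' assume y: "y \<in> f ` Z" "y' \<in> f ` Z" "y \<noteq> y'"
      then obtain z z' where z: "z \<in> Z" "y = f z" "z' \<in> Z" "y' = f z'" by blast
      have "\<bar>(y - y') \<bullet> dir t\<bar> = \<bar>z - z'\<bar>" using f[OF z(1)] f[OF z(3)] z proj[of y y'] by simp
      moreover have "2 * R powr (1 / \<theta>) < \<bar>z - z'\<bar>" using Z(3)[OF z(1,3)] y z by (auto simp: dist_real_def)
      ultimately show "2 * \<delta> < \<bar>(y - y') \<bullet> dir t\<bar>" using \<delta>R by linarith
    qed (use V in auto)
    then obtain k where "k \<in> J" "t \<in> {a + real k * (K / L)..a + (real k + 1) * (K / L)}" using J(2) by blast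
    then show ?thesis unfolding U_def V(4) by blast
  qed
  have "real (card (U ` J)) * L \<le> real (card J) * L"
    using card_image_le[OF J(1), of U] L0 by (intro mult_right_mono) auto
  then have "real (card (U ` J)) * L \<le> 12000 * (2 + ln (1 + L / K)) * covering_number \<delta> X"
    using J(3) by linarith
  moreover have "U k \<subseteq> G21" for k unfolding U_def using span_dir_in_G21 by blast
  ultimately show ?thesis
    using J(1) ediam sub unfolding \<delta>_def[symmetric] by (intro exI[of _ "U ` J"]) auto
qed

text \<open>With strict room in the exponents, \<open>content_bound\<close> makes the contents of
  the covers at scale \<open>r n\<close> a geometric series, and the Borel-Cantelli lemma above
  applies.\<close>

lemma hausdorff_measure_exceptional_arc:
  fixes X :: "(real^2) set"
  assumes X: "bounded X" and \<theta>: "0 < \<theta>" "\<theta> < 1" and \<alpha>: "0 \<le> \<alpha>" and s: "0 \<le> s"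
    and B: "upper_box_dim X < ereal B" and A: "assouad_spectrum \<theta> X < ereal A"
    and less: "B / (1 - \<theta>) + \<alpha> * A < (1 + \<alpha>) * s"
  shows "G21.hausdorff_measure \<alpha> {V \<in> G21. ereal s < assouad_spectrum \<theta> (line_proj V ` X) \<and>
     (\<exists>t c. a \<le> t \<and> t \<le> a + 1 \<and> V = span {dir t} \<and> \<bar>c\<bar> = 1 \<and> line_proj V = (\<lambda>x. c * (x \<bullet> dir t)))} = 0"
proof -
  obtain cB where cB: "cB > 0" "\<And>r. 0 < r \<Longrightarrow> r < 1 \<Longrightarrow> real (covering_number r X) \<le> cB * r powr (- B)"
    using covering_number_le_of_upper_box_dim[OF X B] by blast
  obtain cA where cA: "cA > 0" "\<And>R x. 0 < R \<Longrightarrow> R < 1 \<Longrightarrow> x \<in> X \<Longrightarrow>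
    real (covering_number (R powr (1 / \<theta>)) (X \<inter> cball x R)) \<le> cA * (R / R powr (1 / \<theta>)) powr A"
    using covering_number_le_of_assouad_spectrum[OF \<theta> A] by blast
  have A0: "0 < A" using assouad_spectrum_nonneg[of \<theta> X] A by (metis ereal_less(2) le_less_trans)
  define \<mu> where "\<mu> = 1 / \<theta> - 1"
  have \<mu>: "0 < \<mu>" using \<theta> by (simp add: \<mu>_def field_simps)
  \<comment> \<open>At scale \<open>r n\<close> the covering radius is
    \<open>r n powr (1 / \<theta>)\<close>, which costs the exponent \<open>B / \<theta>\<close>,
    while the ratio of radii is \<open>r n powr (- \<mu>)\<close>. Multiplying the inequality
    between dimensions by \<open>\<mu>\<close> turns it into one between exponents of
    \<open>r n\<close>.\<close>
  have B\<mu>: "B / \<theta> = \<mu> * (B / (1 - \<theta>))" using \<theta> by (simp add: \<mu>_def field_simps)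
  have exps: "B / \<theta> + \<alpha> * (\<mu> * A) < (1 + \<alpha>) * (\<mu> * s)"
    using mult_strict_left_mono[OF less \<mu>] by (simp add: B\<mu> algebra_simps)
  \<comment> \<open>Collects the factor from radii as large as \<open>2 * r n\<close> and the half
    lost on passing to separated points.\<close>
  define c1 where "c1 = 2 powr (- (\<mu> * s)) / 2"
  have c1: "0 < c1" by (simp add: c1_def)
  obtain c e where c: "0 < c" and e: "0 < e" and
    content: "\<And>x L K P. 0 < x \<Longrightarrow> x < 1 \<Longrightarrow> L = c1 * x powr (- (\<mu> * s)) \<Longrightarrow> K = cA * x powr (- (\<mu> * A)) \<Longrightarrow> 0 \<le> P \<Longrightarrow>
       P \<le> cB * x powr (- (B / \<theta>)) \<Longrightarrow> 12000 * (2 + ln (1 + L / K)) * P / L * (K / L) powr \<alpha> \<le> c * x powr e"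
    using content_bound[OF _ _ \<alpha> exps c1 cA(1) cB(1)] \<mu> s A0 by auto
  define r where "r n = (1 / 2 :: real) ^ Suc n" for n
  have r: "0 < r n" "r n < 1" for n unfolding r_def by (rule zero_less_power, simp, rule power_Suc_less_one) auto
  define K where "K n = cA * r n powr (- (\<mu> * A))" for n
  define L where "L n = c1 * r n powr (- (\<mu> * s))" for n
  have K: "0 < K n" and L: "0 < L n" for n
    using cA(1) c1 r(1)[of n] by (simp_all add: K_def L_def)
  have L_eq: "L n = (2 * r n) powr (- ((1 / \<theta> - 1) * s)) / 2" for n
    using r[of n] by (simp add: L_def c1_def powr_mult \<mu>_def)
  have ratio: "r n / r n powr (1 / \<theta>) = r n powr (- \<mu>)" for n
    using r[of n] by (simp add: \<mu>_def powr_diff)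
  define F where "F n = {V \<in> bad_lines X \<theta> s (r n). \<exists>t c. a \<le> t \<and> t \<le> a + 1 \<and> V = span {dir t}
        \<and> \<bar>c\<bar> = 1 \<and> line_proj V = (\<lambda>x. c * (x \<bullet> dir t))}" for n
  have "G21.hausdorff_measure \<alpha> {V. \<exists>\<^sub>\<infinity>n. V \<in> F n} = 0"
  proof (rule G21.hausdorff_measure_limsup_eq_0[OF \<alpha>])
    show "0 < K n / L n" for n using K L by simp
    have "r n powr e = (1 / 2) powr e * ((1 / 2) powr e) ^ n" for n
      by (simp add: r_def powr_mult power_Suc[symmetric] powr_realpow[symmetric] powr_powr mult.commute del: power_Suc)
        (simp add: powr_add[symmetric] algebra_simps)
    moreover have "summable (\<lambda>n. c * ((1 / 2) powr e * ((1 / 2) powr e) ^ n))"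
      using e by (intro summable_mult summable_geometric)
        (use powr_less_mono2[of e "1 / 2" 1] in simp)
    ultimately show "summable (\<lambda>n. c * r n powr e)" by simp
    fix n
    have KX: "real (covering_number (r n powr (1 / \<theta>)) (X \<inter> cball x (r n))) \<le> K n" if "x \<in> X" for x
      using cA(2)[OF r that] by (simp add: ratio powr_powr K_def)
    obtain \<U> where U: "finite \<U>" "F n \<subseteq> \<Union>\<U>" "\<forall>U\<in>\<U>. U \<subseteq> G21 \<and> G21.ediam U \<le> ennreal (K n / L n)"
      "real (card \<U>) * L n \<le> 12000 * (2 + ln (1 + L n / K n)) * covering_number (r n powr (1 / \<theta>)) X"
      using bad_lines_cover[OF X \<theta> s r[of n] K[of n] L_eq[of n] KX, where a = a] unfolding F_def by blast
    let ?P = "real (covering_number (r n powr (1 / \<theta>)) X)"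
    have "r n powr (1 / \<theta>) < 1" using powr_less_mono2[of "1 / \<theta>" "r n" 1] r[of n] \<theta> by simp
    then have P: "?P \<le> cB * r n powr (- (B / \<theta>))"
      using cB(2)[of "r n powr (1 / \<theta>)"] r[of n] by (simp add: powr_powr)
    have "real (card \<U>) \<le> 12000 * (2 + ln (1 + L n / K n)) * ?P / L n"
      using U(4) L[of n] by (simp add: pos_le_divide_eq)
    then have "real (card \<U>) * (K n / L n) powr \<alpha> \<le> 12000 * (2 + ln (1 + L n / K n)) * ?P / L n * (K n / L n) powr \<alpha>"
      by (intro mult_right_mono) auto
    also have "\<dots> \<le> c * r n powr e" by (rule content[OF r L_def K_def _ P]) simp
    finally show "\<exists>\<U>. finite \<U> \<and> F n \<subseteq> \<Union>\<U> \<and> (\<forall>U\<in>\<U>. U \<subseteq> G21 \<and> G21.ediam U \<le> ennreal (K n / L n))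
        \<and> real (card \<U>) * (K n / L n) powr \<alpha> \<le> c * r n powr e"
      using U by (intro exI[of _ \<U>]) simp
  qed
  then show ?thesis
  proof (rule G21.hausdorff_measure_eq_0_mono)
    show "{V \<in> G21. ereal s < assouad_spectrum \<theta> (line_proj V ` X) \<and>
        (\<exists>t c. a \<le> t \<and> t \<le> a + 1 \<and> V = span {dir t} \<and> \<bar>c\<bar> = 1 \<and> line_proj V = (\<lambda>x. c * (x \<bullet> dir t)))}
      \<subseteq> {V. \<exists>\<^sub>\<infinity>n. V \<in> F n}"
      using infinitely_often_bad[OF X \<theta> s] by (auto simp: F_def r_def simp del: power_Suc)
  qed
qed

text \<open>The strict room is recovered by a countable union over the levels
  \<open>T + 1 / real (Suc k)\<close> and over the arcs of length 1 that start at natural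
  numbers.\<close>

lemma hausdorff_measure_exceptional:
  fixes X :: "(real^2) set"
  assumes X: "bounded X" and \<theta>: "0 < \<theta>" "\<theta> < 1" and \<alpha>: "0 \<le> \<alpha>" and T: "0 \<le> T"
    and B: "upper_box_dim X = ereal B" and A: "assouad_spectrum \<theta> X = ereal A"
    and le: "B / (1 - \<theta>) + \<alpha> * A \<le> (1 + \<alpha>) * T"
  shows "G21.hausdorff_measure \<alpha> {V \<in> G21. ereal T < assouad_spectrum \<theta> (line_proj V ` X)} = 0"
proof -
  define Q where "Q a s = {V \<in> G21. ereal s < assouad_spectrum \<theta> (line_proj V ` X) \<and>
     (\<exists>t c. a \<le> t \<and> t \<le> a + 1 \<and> V = span {dir t} \<and> \<bar>c\<bar> = 1 \<and> line_proj V = (\<lambda>x. c * (x \<bullet> dir t)))}" for a s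
  have "G21.hausdorff_measure \<alpha> (Q a s) = 0" if "T < s" for a s
  proof -
    \<comment> \<open>Chosen so that raising both dimensions by \<open>\<epsilon>\<close> consumes
      exactly half of the slack \<open>(1 + \<alpha>) * (s - T)\<close>.\<close>
    define \<epsilon> where "\<epsilon> = (1 + \<alpha>) * (s - T) / (2 * (1 / (1 - \<theta>) + \<alpha>))"
    have d: "0 < 1 / (1 - \<theta>) + \<alpha>" using \<theta> \<alpha> by (simp add: add_pos_nonneg)
    have \<epsilon>: "0 < \<epsilon>" using d that \<alpha> by (simp add: \<epsilon>_def)
    have "(B + \<epsilon>) / (1 - \<theta>) + \<alpha> * (A + \<epsilon>) = B / (1 - \<theta>) + \<alpha> * A + (1 / (1 - \<theta>) + \<alpha>) * \<epsilon>"
      by (simp add: add_divide_distrib algebra_simps)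
    also have "(1 / (1 - \<theta>) + \<alpha>) * \<epsilon> = (1 + \<alpha>) * (s - T) / 2"
      using d unfolding \<epsilon>_def by (metis (no_types, opaque_lifting) less_irrefl nonzero_mult_divide_mult_cancel_left mult.commute times_divide_eq_right)
    also have "B / (1 - \<theta>) + \<alpha> * A + (1 + \<alpha>) * (s - T) / 2 < (1 + \<alpha>) * s"
    proof -
      have "0 < (1 + \<alpha>) * (s - T)" using that \<alpha> by simp
      then have "(1 + \<alpha>) * (s - T) / 2 < (1 + \<alpha>) * (s - T)" by linarith
      also have "\<dots> = (1 + \<alpha>) * s - (1 + \<alpha>) * T" by (simp add: algebra_simps)
      finally show ?thesis using le by linarith
    qed
    finally have less: "(B + \<epsilon>) / (1 - \<theta>) + \<alpha> * (A + \<epsilon>) < (1 + \<alpha>) * s" .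
    show ?thesis unfolding Q_def
      by (rule hausdorff_measure_exceptional_arc[OF X \<theta> \<alpha> _ _ _ less]) (use that T \<epsilon> in \<open>auto simp: A B\<close>)
  qed
  then have "G21.hausdorff_measure \<alpha> (\<Union>j k :: nat. Q (real j) (T + 1 / real (Suc k))) = 0"
    by (intro G21.hausdorff_measure_UN_eq_0) auto
  then show ?thesis
  proof (rule G21.hausdorff_measure_eq_0_mono, intro subsetI)
    fix V assume "V \<in> {V \<in> G21. ereal T < assouad_spectrum \<theta> (line_proj V ` X)}"
    then have V: "V \<in> G21" "ereal T < assouad_spectrum \<theta> (line_proj V ` X)" by auto
    obtain s where s: "T < s" "ereal s < assouad_spectrum \<theta> (line_proj V ` X)"
      using ereal_dense2[OF V(2)] by auto
    obtain k where "1 / real (Suc k) < s - T"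
      using reals_Archimedean[of "s - T"] s(1) by (auto simp: inverse_eq_divide)
    then have k: "ereal (T + 1 / real (Suc k)) < assouad_spectrum \<theta> (line_proj V ` X)"
      by (intro le_less_trans[OF _ s(2)]) auto
    obtain t c where t: "0 \<le> t" "V = span {dir t}" "\<bar>c\<bar> = 1" "line_proj V = (\<lambda>x. c * (x \<bullet> dir t))"
      using G21_dir[OF V(1)] .
    have "real (nat \<lfloor>t\<rfloor>) \<le> t" "t \<le> real (nat \<lfloor>t\<rfloor>) + 1" using t(1) by linarith+
    then have "V \<in> Q (real (nat \<lfloor>t\<rfloor>)) (T + 1 / real (Suc k))"
      unfolding Q_def using V(1) k t(2-4) by blast
    then show "V \<in> (\<Union>j k :: nat. Q (real j) (T + 1 / real (Suc k)))" by blast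
  qed
qed

theorem theorem2p5:
  fixes X :: "(real^2) set" and \<theta> \<alpha> :: real
  assumes "bounded X" and "0 < \<theta>" "\<theta> < 1" and "0 \<le> \<alpha>" "\<alpha> < 1"
  shows "G21.hausdorff_dim
           {V \<in> G21. assouad_spectrum \<theta> (line_proj V ` X) >
              ereal (1 / (1 + \<alpha>)) *
                (upper_box_dim X / ereal (1 - \<theta>) + ereal \<alpha> * assouad_spectrum \<theta> X)}
         \<le> ereal \<alpha>"
proof (rule G21.hausdorff_dim_le[OF assms(4)])
  let ?S = "\<lambda>T. {V \<in> G21. assouad_spectrum \<theta> (line_proj V ` X) > T}"
  let ?T = "ereal (1 / (1 + \<alpha>)) * (upper_box_dim X / ereal (1 - \<theta>) + ereal \<alpha> * assouad_spectrum \<theta> X)"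
  show "G21.hausdorff_measure \<alpha> (?S ?T) = 0"
  proof (cases "upper_box_dim X")
    case (real B)
    have B0: "0 \<le> B" using upper_box_dim_nonneg[OF assms(1)] real by simp
    \<comment> \<open>Only finiteness of the spectrum is wanted, so any exponent above the box
      dimension will do.\<close>
    have "assouad_spectrum \<theta> X \<le> ereal ((B + 1) / (1 - \<theta>))"
      using assouad_spectrum_le_of_upper_box_dim[OF assms(1-3), of "B + 1"] real by simp
    then obtain A where A: "assouad_spectrum \<theta> X = ereal A" "0 \<le> A"
      using assouad_spectrum_nonneg[of \<theta> X] by (cases "assouad_spectrum \<theta> X") auto
    have T: "?T = ereal (1 / (1 + \<alpha>) * (B / (1 - \<theta>) + \<alpha> * A))" using assms by (simp add: real A)
    show ?thesis unfolding T
    proof (rule hausdorff_measure_exceptional[OF assms(1-4) _ real A(1)])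
      show "0 \<le> 1 / (1 + \<alpha>) * (B / (1 - \<theta>) + \<alpha> * A)" using assms B0 A(2) by simp
    qed (use assms(4) in simp)
  next
    case PInf
    \<comment> \<open>Nonnegativity of the second summand keeps the sum at infinity. The threshold
      is then infinite and the exceptional set empty, hence null.\<close>
    have "0 \<le> ereal \<alpha> * assouad_spectrum \<theta> X" using assms assouad_spectrum_nonneg[of \<theta> X] by simp
    then have "upper_box_dim X / ereal (1 - \<theta>) + ereal \<alpha> * assouad_spectrum \<theta> X = \<infinity>"
      using assms by (auto simp: PInf)
    then have T: "?T = \<infinity>" using assms by (simp add: ereal_mult_infty)
    have "G21.hausdorff_measure \<alpha> {} = 0"
      unfolding G21.hausdorff_measure_eq_0_iff_small_cover G21.small_cover_def
      by (intro allI impI exI[of _ "\<lambda>_. {}"]) (simp add: G21.diam_pow_def G21.ediam_def)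
    then show ?thesis unfolding T by simp
  next
    case MInf
    then show ?thesis using upper_box_dim_nonneg[OF assms(1)] by simp
  qed
qed

end
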